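(* (1) For every real constant $c>0$ there exists a set $\mathcal{N}_c\subseteq\mathbb{N}$ of positive natural density such that for all $q\in\mathcal{N}_c$, all nonprincipal Dirichlet characters $\chi$ modulo $q$ and all real $x$, $$\left|\sum_{m\leq x}\chi(m)\right|\ <\ c\sqrt{q}\,\bigl(\log q+\log\log q+\log\log\log q+4\bigr)=(c+o(1))\sqrt{q}\log q.$$ (2) There are infinitely many positive integers $q$ such that for every nonprincipal Dirichlet character $\chi$ modulo $q$ and all real $x$, $$\left|\sum_{m\leq x}\chi(m)\right|\ <\ \frac{\sqrt{q}}{e^{\gamma}\log\log q}\bigl(\log q+\log\log q+\log\log\log q+4\bigr)=(e^{-\gamma}+o(1))\frac{\sqrt{q}\log q}{\log\log q}.$$
   Context: The sums run over positive integers $m\leq x$. $\gamma$ is the Euler constant, $\log$ is the natural logarithm, and $o(1)$ denotes a quantity tending to $0$ as $q\to\infty$. The expression $\log\log\log q$ is defined for integers $q\geq 3$, and the moduli $q$ in question are understood to satisfy this. The natural density of a set $\mathcal{N}\subseteq\mathbb{N}$ is $\lim_{X\to\infty}\frac{1}{X}\#\{n\leq X : n\in\mathcal{N}\}$. *)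

theory Defs
  imports "HOL-Analysis.Analysis"
begin

definition dirichlet_character :: "nat \<Rightarrow> (int \<Rightarrow> complex) \<Rightarrow> bool" where
  "dirichlet_character q chi \<longleftrightarrow>
     (\<forall>n. chi (n + int q) = chi n) \<and>
     (\<forall>m n. chi (m * n) = chi m * chi n) \<and>
     (\<forall>n. chi n \<noteq> 0 \<longleftrightarrow> coprime n (int q))"

definition principal_character :: "nat \<Rightarrow> int \<Rightarrow> complex" where
  "principal_character q n = (if coprime n (int q) then 1 else 0)"

definition nonprincipal_character :: "nat \<Rightarrow> (int \<Rightarrow> complex) \<Rightarrow> bool" where
  "nonprincipal_character q chi \<longleftrightarrow> dirichlet_character q chi \<and> chi \<noteq> principal_character q"

definition has_natural_density :: "nat set \<Rightarrow> real \<Rightarrow> bool" where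
  "has_natural_density N d \<longleftrightarrow>
     (\<lambda>X::nat. real (card {n \<in> N. 1 \<le> n \<and> n \<le> X}) / real X) \<longlonglongrightarrow> d"

(* The iterated logarithms have their usual meaning only for q \<ge> 3;
   at smaller q the value is an artefact of the totality of ln. *)
definition log_factor :: "nat \<Rightarrow> real" where
  "log_factor q = ln (real q) + ln (ln (real q)) + ln (ln (ln (real q))) + 4"

end

theory Submission
  imports Defs "HOL-Number_Theory.Number_Theory" "HOL-Real_Asymp.Real_Asymp"
begin

text \<open>
  Both parts rest on the bound, for arbitrary \<open>a\<close>,
  \<open>\<Sum>u. 1 / \<bar>sin (\<pi> a u / n)\<bar> \<le> (8/9) \<phi>(n) (log n + 3 log rad n + 1)\<close>,
  where \<open>u\<close> runs over the units modulo \<open>n\<close>. The factor \<open>\<phi>(n)\<close> comes from an elementary sieve for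
  \<open>\<Sum>1/b\<close> over \<open>b\<close> coprime to \<open>n\<close>; it makes the bounds small when \<open>\<phi>(q)/q\<close> is.

  Part 1: the finite Fourier coefficients of \<open>\<chi>\<close> have absolute values that are invariant under
  multiplication by units, so the \<open>1/sin\<close> weights of the completed sum may be averaged over the
  units. Parseval's identity then gives \<open>O(\<surd>\<phi>(q) log q)\<close> for all nonprincipal \<open>\<chi>\<close>, primitive or
  not, and it suffices to let \<open>q\<close> run over the large multiples of \<open>n!\<close> for a fixed large \<open>n\<close>.

  Part 2: take \<open>q = H\<^sup>2\<close> with \<open>H = (n!)\<^sup>1\<^sup>0\<^sup>0\<close>. On a residue class modulo \<open>H\<close> the character is a
  geometric progression, which gives the bound \<open>(8/9) \<phi>(H) (log H + 3 log rad H + 1)\<close>. The leading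
  constant, essentially \<open>4/9\<close>, lies below \<open>exp(-\<gamma>)\<close>, so the trivial bound \<open>\<phi>(H)/H \<le> 1 / log n\<close>
  can replace Mertens' theorem; the exponent \<open>100\<close> makes \<open>log rad H\<close> negligible against \<open>log H\<close>.
\<close>

section \<open>Reciprocals of integers without small prime factors\<close>

text \<open>\<open>A\<close> is meant to be a set of primes; keeping it as a parameter allows
  sieving by one prime at a time.\<close>

definition sieved_sum :: "nat set \<Rightarrow> nat \<Rightarrow> real" where
  "sieved_sum A N = (\<Sum>b | b \<in> {1..N} \<and> (\<forall>p\<in>A. \<not> p dvd b). 1 / real b)"

definition rad :: "nat \<Rightarrow> nat" where
  "rad k = \<Prod>(prime_factors k)"

lemma sieved_sum_empty: "sieved_sum {} N = harm N"
  by (auto simp: sieved_sum_def harm_def field_simps intro!: sum.cong)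

lemma sieved_sum_nonneg: "sieved_sum A N \<ge> 0"
  unfolding sieved_sum_def by (intro sum_nonneg) auto

lemma sieved_sum_mono: "M \<le> N \<Longrightarrow> sieved_sum A M \<le> sieved_sum A N"
  unfolding sieved_sum_def by (intro sum_mono2) auto

text \<open>The terms divisible by \<open>p\<close> are \<open>b = p * c\<close> with
  \<open>c\<close> at most \<open>N div p\<close>, and such a \<open>b\<close> avoids
  \<open>A\<close> exactly when \<open>c\<close> does, because \<open>p\<close> is a prime outside
  \<open>A\<close>.\<close>

lemma sieved_sum_insert:
  assumes "prime p" "p \<notin> A" "\<And>r. r \<in> A \<Longrightarrow> prime r"
  shows "sieved_sum A N = sieved_sum (insert p A) N + sieved_sum A (N div p) / real p"
proof -
  let ?S = "{b. b \<in> {1..N} \<and> (\<forall>r\<in>A. \<not> r dvd b)}"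
  let ?T = "{b. b \<in> {1..N div p} \<and> (\<forall>r\<in>A. \<not> r dvd b)}"
  have p0: "p > 0" using assms(1) prime_gt_0_nat by blast
  have eq: "{b\<in>?S. p dvd b} = (\<lambda>b. p * b) ` ?T"
  proof (intro equalityI subsetI)
    fix b assume b: "b \<in> {b\<in>?S. p dvd b}"
    then obtain c where c: "b = p * c" by (auto elim: dvdE)
    have "c \<in> ?T" using b c p0
      by (auto simp: less_eq_div_iff_mult_less_eq mult.commute intro: Suc_leI)
    with c show "b \<in> (\<lambda>b. p * b) ` ?T" by blast
  next
    fix b assume "b \<in> (\<lambda>b. p * b) ` ?T"
    then obtain c where c: "b = p * c" "c \<in> ?T" by blast
    have "\<not> r dvd b" if "r \<in> A" for r
    proof
      assume "r dvd b"
      with c have "r dvd p \<or> r dvd c"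
        using assms(3)[OF that] by (simp add: prime_dvd_mult_iff)
      moreover have "\<not> r dvd c" using c that by auto
      ultimately have "r = p" using primes_dvd_imp_eq assms that by blast
      with assms that show False by auto
    qed
    moreover have "b \<in> {1..N}" using c p0
      by (auto simp: less_eq_div_iff_mult_less_eq mult.commute intro: Suc_leI)
    ultimately show "b \<in> {b\<in>?S. p dvd b}" using c by auto
  qed
  have "sieved_sum A N = (\<Sum>b\<in>{b\<in>?S. \<not> p dvd b}. 1 / real b) + (\<Sum>b\<in>{b\<in>?S. p dvd b}. 1 / real b)"
    unfolding sieved_sum_def by (subst sum.union_disjoint[symmetric]) (auto intro!: sum.cong)
  also have "{b\<in>?S. \<not> p dvd b} = {b. b \<in> {1..N} \<and> (\<forall>r\<in>insert p A. \<not> r dvd b)}" by auto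
  also have "(\<Sum>b\<in>{b\<in>?S. p dvd b}. 1 / real b) = (\<Sum>b\<in>?T. 1 / real (p * b))"
    unfolding eq using p0 by (subst sum.reindex) (auto simp: inj_on_def)
  also have "\<dots> = sieved_sum A (N div p) / real p"
    unfolding sieved_sum_def sum_divide_distrib by (simp add: field_simps)
  finally show ?thesis unfolding sieved_sum_def .
qed

text \<open>Sieving by \<open>p\<close> removes \<open>1 / p\<close> times a sieved sum over a
  shorter range, hence at most the fraction \<open>1 / p\<close>. Where few \<open>b\<close>
  survive, this bounds the Euler product from above.\<close>

lemma euler_product_mult_harm_le_sieved_sum:
  assumes "finite A" "\<And>r. r \<in> A \<Longrightarrow> prime r"
  shows "(\<Prod>p\<in>A. 1 - 1 / real p) * harm N \<le> sieved_sum A N"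
  using assms
proof (induction A rule: finite_induct)
  case (insert p A)
  have p: "real p > 1" using insert.prems prime_gt_1_nat by auto
  have "sieved_sum A N \<le> sieved_sum (insert p A) N + sieved_sum A N / real p"
    using sieved_sum_insert[of p A N] insert sieved_sum_mono[of "N div p" N A] p
    by (auto intro!: divide_right_mono)
  hence "(1 - 1 / real p) * sieved_sum A N \<le> sieved_sum (insert p A) N"
    by (simp add: algebra_simps)
  moreover have "(1 - 1 / real p) * ((\<Prod>p\<in>A. 1 - 1 / real p) * harm N) \<le> (1 - 1 / real p) * sieved_sum A N"
    using insert p by (intro mult_left_mono) auto
  ultimately show ?case using insert by (simp add: mult.assoc)
qed (simp add: sieved_sum_empty)

text \<open>The survivors \<open>b\<close>, multiplied by prime powers from \<open>A\<close> with
  exponents at most 3, give distinct integers up to \<open>N * \<Prod>A ^ 3\<close>. Expanding the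
  left side thus yields reciprocals of distinct integers.\<close>

lemma sieved_sum_mult_prod_le_harm:
  assumes "finite A" "\<And>r. r \<in> A \<Longrightarrow> prime r"
  shows "sieved_sum A N * (\<Prod>p\<in>A. 1 + 1 / real p + 1 / real p ^ 2 + 1 / real p ^ 3) \<le> harm (N * \<Prod>A ^ 3)"
  using assms
proof (induction A arbitrary: N rule: finite_induct)
  case (insert p A)
  let ?F = "sieved_sum A" and ?G = "sieved_sum (insert p A)"
  have p: "p > 1" using insert.prems prime_gt_1_nat by auto
  \<comment> \<open>Each extension of the range by a factor \<open>p\<close> supplies one more power
    of \<open>1 / p\<close>; three of them build the cubic truncation of the geometric
    series.\<close>
  have step: "?F (M * p) \<ge> ?G N + ?F M / real p" if "N \<le> M" for M
  proof -
    have "?G N \<le> ?G (M * p)" using that p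
      by (intro sieved_sum_mono) (metis le_trans less_imp_le mult.right_neutral mult_le_mono2)
    thus ?thesis using sieved_sum_insert[of p A "M * p"] insert p by auto
  qed
  have le: "N \<le> N * p" "N \<le> N * p * p" using p by auto
  have "?F N \<ge> ?G N"
    using sieved_sum_insert[of p A N] insert sieved_sum_nonneg[of A "N div p"] by simp
  hence "?F (N * p) \<ge> ?G N + ?G N / real p"
    using step[of N] by (smt (verit, best) divide_right_mono of_nat_0_le_iff order_refl)
  hence "?F (N * p * p) \<ge> ?G N + (?G N + ?G N / real p) / real p"
    using step[OF le(1)] by (smt (verit, best) divide_right_mono of_nat_0_le_iff)
  hence "?F (N * p * p * p) \<ge> ?G N + (?G N + (?G N + ?G N / real p) / real p) / real p"
    using step[OF le(2)] by (smt (verit, best) divide_right_mono of_nat_0_le_iff)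
  also have "?G N + (?G N + (?G N + ?G N / real p) / real p) / real p
     = ?G N * (1 + 1 / real p + 1 / real p ^ 2 + 1 / real p ^ 3)"
    using p by (simp add: field_simps power2_eq_square power3_eq_cube)
  finally have "?G N * (1 + 1 / real p + 1 / real p ^ 2 + 1 / real p ^ 3)
       * (\<Prod>p\<in>A. 1 + 1 / real p + 1 / real p ^ 2 + 1 / real p ^ 3)
     \<le> ?F (N * p * p * p) * (\<Prod>p\<in>A. 1 + 1 / real p + 1 / real p ^ 2 + 1 / real p ^ 3)"
    by (intro mult_right_mono prod_nonneg) auto
  also have "\<dots> \<le> harm (N * p * p * p * \<Prod>A ^ 3)"
    using insert by auto
  finally show ?case using insert
    by (simp add: mult_ac power_mult_distrib power3_eq_cube)
qed (simp add: sieved_sum_empty)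

section \<open>Partial products of the Euler product of 1/zeta(4)\<close>

lemma one_minus_sum_le_prod:
  fixes f :: "'a \<Rightarrow> real"
  assumes "finite A" "\<And>x. x \<in> A \<Longrightarrow> 0 \<le> f x \<and> f x \<le> 1"
  shows "1 - sum f A \<le> (\<Prod>x\<in>A. 1 - f x)"
  using assms
proof (induction A rule: finite_induct)
  case (insert x A)
  have "sum f A \<ge> 0" using insert by (intro sum_nonneg) auto
  have "1 - sum f (insert x A) \<le> (1 - f x) * (1 - sum f A)"
    using insert \<open>sum f A \<ge> 0\<close> by (simp add: algebra_simps)
  also have "\<dots> \<le> (1 - f x) * (\<Prod>x\<in>A. 1 - f x)"
    using insert by (intro mult_left_mono) auto
  finally show ?case using insert by simp
qed simp

lemma sum_inverse_fourth_power_le: "(\<Sum>n=2..M. 1 / real n ^ 4) \<le> 1 / 4"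
proof -
  \<comment> \<open>Telescoping needs the stronger bound with the tail \<open>1 / (4 * M)\<close>;
    the increment is controlled by \<open>4 * x \<le> (x + 1) ^ 3\<close>.\<close>
  have "(\<Sum>n=2..M. 1 / real n ^ 4) \<le> 1 / 4 - 1 / (4 * real M)" if "M \<ge> 1"
    using that
  proof (induction M rule: dec_induct)
    case (step M)
    define x where "x = real M"
    have x: "x \<ge> 1" using step by (simp add: x_def)
    have "x \<le> x * x" "0 \<le> x * (x * x)" using x mult_mono[of 1 x x x] by auto
    moreover have "(x + 1) ^ 3 = x * (x * x) + 3 * (x * x) + 3 * x + 1"
      by (simp add: power3_eq_cube algebra_simps)
    ultimately have "4 * x \<le> (x + 1) ^ 3" using x by linarith
    hence "4 * x * (x + 1) \<le> (x + 1) ^ 3 * (x + 1)" using x by (intro mult_right_mono) auto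
    also have "\<dots> = (x + 1) ^ 4" by (simp add: numeral_eq_Suc)
    finally have "1 / (x + 1) ^ 4 \<le> 1 / (4 * x * (x + 1))"
      using x by (intro divide_left_mono) auto
    also have "\<dots> = 1 / (4 * x) - 1 / (4 * (x + 1))" using x by (simp add: field_simps)
    finally have "1 / real (Suc M) ^ 4 \<le> 1 / (4 * real M) - 1 / (4 * real (Suc M))"
      by (simp add: x_def add.commute)
    thus ?case using step by simp
  qed simp
  moreover have "1 / 4 - 1 / (4 * real M) \<le> 1 / 4" by simp
  ultimately show ?thesis by (cases "M \<ge> 1") (linarith, simp)
qed

text \<open>Comparison with the sum over all integers from 2 on makes the constant uniform in
  \<open>A\<close>. It is the price of truncating the Euler factors at the third power.\<close>

lemma prod_one_minus_inverse_fourth_power_ge: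
  assumes "finite A" "\<And>r. r \<in> A \<Longrightarrow> prime r"
  shows "(\<Prod>p\<in>A. 1 - 1 / real p ^ 4) \<ge> 3 / 4"
proof -
  have "A \<subseteq> {2..Max (insert 2 A)}" using assms prime_ge_2_nat by auto
  hence "(\<Sum>p\<in>A. 1 / real p ^ 4) \<le> (\<Sum>p=2..Max (insert 2 A). 1 / real p ^ 4)"
    by (intro sum_mono2) auto
  also have "\<dots> \<le> 1 / 4" by (rule sum_inverse_fourth_power_le)
  finally have "1 - (\<Sum>p\<in>A. 1 / real p ^ 4) \<ge> 3 / 4" by simp
  also have "1 - (\<Sum>p\<in>A. 1 / real p ^ 4) \<le> (\<Prod>p\<in>A. 1 - 1 / real p ^ 4)"
    using assms prime_gt_0_nat
    by (intro one_minus_sum_le_prod) (auto simp: divide_le_eq Suc_leI)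
  finally show ?thesis .
qed

section \<open>Harmonic sums, radicals and bounds involving the totient\<close>

lemma harm_le_ln_plus_1: "n > 0 \<Longrightarrow> harm n \<le> ln (real n) + 1"
  using euler_mascheroni_sequence_decreasing[of 1 n] by (simp add: harm_def)

lemma rad_pos: "rad k > 0"
  unfolding rad_def by (intro prod_pos) (auto simp: in_prime_factors_iff prime_gt_0_nat)

lemma rad_le: "k > 0 \<Longrightarrow> rad k \<le> k"
proof -
  assume k: "k > 0"
  have "rad k \<le> (\<Prod>p\<in>prime_factors k. p ^ multiplicity p k)"
    unfolding rad_def
  proof (rule prod_mono, safe)
    fix p assume p: "p \<in> prime_factors k"
    hence "multiplicity p k \<ge> 1" by (simp add: prime_factors_multiplicity)
    thus "p \<le> p ^ multiplicity p k"
      using p by (metis in_prime_factors_iff power_increasing power_one_right prime_ge_1_nat)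
  qed
  also have "\<dots> = k" using prime_factorization_nat[OF k] by simp
  finally show ?thesis .
qed

lemma rad_mono: "k dvd n \<Longrightarrow> n > 0 \<Longrightarrow> rad k \<le> rad n"
proof -
  assume kn: "k dvd n" "n > 0"
  have "rad k dvd rad n" unfolding rad_def
    using kn by (intro prod_dvd_prod_subset dvd_prime_factors) auto
  thus ?thesis using rad_pos dvd_imp_le by blast
qed

text \<open>\<open>P\<close> is \<open>totient k / k\<close>, and \<open>P * Q\<close> is the
  product of the \<open>1 - 1 / p ^ 4\<close>, so \<open>1 / Q\<close> is at most
  \<open>4 / 3 * P\<close>. The range \<open>N * rad k ^ 3\<close> of the harmonic sum explains the
  term \<open>3 * ln (rad k)\<close>.\<close>

lemma sieved_sum_prime_factors_le:
  assumes "k > 0" "N > 0"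
  shows "real k * sieved_sum (prime_factors k) N
    \<le> 4 / 3 * real (totient k) * (ln (real N) + 3 * ln (real (rad k)) + 1)"
proof -
  let ?A = "prime_factors k"
  let ?L = "ln (real N) + 3 * ln (real (rad k)) + 1"
  have pr: "finite ?A" "\<And>r. r \<in> ?A \<Longrightarrow> prime r" by auto
  define P where "P = (\<Prod>p\<in>?A. 1 - 1 / real p)"
  define Q where "Q = (\<Prod>p\<in>?A. 1 + 1 / real p + 1 / real p ^ 2 + 1 / real p ^ 3)"
  have "P \<ge> 0" unfolding P_def
    by (intro prod_nonneg) (auto simp: in_prime_factors_iff prime_gt_0_nat Suc_leI)
  have "P * Q = (\<Prod>p\<in>?A. 1 - 1 / real p ^ 4)"
    unfolding P_def Q_def prod.distrib[symmetric]
  proof (rule prod.cong)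
    fix p assume "p \<in> ?A"
    hence "real p \<noteq> 0" by (auto simp: in_prime_factors_iff)
    thus "(1 - 1 / real p) * (1 + 1 / real p + 1 / real p ^ 2 + 1 / real p ^ 3) = 1 - 1 / real p ^ 4"
      by (simp add: field_simps power2_eq_square power3_eq_cube numeral_eq_Suc)
  qed simp
  hence PQ: "P * Q \<ge> 3 / 4"
    using prod_one_minus_inverse_fourth_power_ge[OF pr] by simp
  have "sieved_sum ?A N * Q \<le> harm (N * rad k ^ 3)"
    using sieved_sum_mult_prod_le_harm[OF pr] unfolding Q_def rad_def by simp
  also have "\<dots> \<le> ln (real (N * rad k ^ 3)) + 1"
    using assms rad_pos[of k] by (intro harm_le_ln_plus_1) auto
  also have "\<dots> = ?L"
    using assms rad_pos[of k] by (simp add: ln_mult ln_realpow)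
  finally have 1: "sieved_sum ?A N * Q \<le> ?L" .
  have "sieved_sum ?A N * (3 / 4) \<le> sieved_sum ?A N * (P * Q)"
    using PQ sieved_sum_nonneg by (intro mult_left_mono) auto
  also have "\<dots> \<le> P * ?L" using mult_left_mono[OF 1 \<open>P \<ge> 0\<close>] by (simp add: mult_ac)
  finally have "real k * (sieved_sum ?A N * (3 / 4)) \<le> real k * (P * ?L)"
    by (intro mult_left_mono) auto
  thus ?thesis using totient_formula2[of k] by (simp add: P_def field_simps)
qed

text \<open>Every prime up to \<open>n\<close> divides \<open>k\<close>, so no number up to
  \<open>n\<close> except 1 survives sieving by the primes of \<open>k\<close>. Hence the Euler
  product \<open>totient k / k\<close> times \<open>harm n\<close> is at most 1.\<close>

lemma totient_mult_ln_le:
  assumes "fact n dvd k" "k > 0"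
  shows "real (totient k) * ln (real n + 1) \<le> real k"
proof -
  let ?A = "prime_factors k"
  define P where "P = (\<Prod>p\<in>?A. 1 - 1 / real p)"
  have "P \<ge> 0" unfolding P_def
    by (intro prod_nonneg) (auto simp: in_prime_factors_iff prime_gt_0_nat Suc_leI)
  have "b = 1" if b: "b \<in> {1..n}" "\<forall>p\<in>?A. \<not> p dvd b" for b
  proof (rule ccontr)
    assume "b \<noteq> 1"
    then obtain p where p: "prime p" "p dvd b" using prime_factor_nat by blast
    have "b dvd fact n" using b by (intro dvd_fact) auto
    hence "p \<in> ?A" using p assms by (auto simp: in_prime_factors_iff intro: dvd_trans)
    with b p show False by auto
  qed
  hence "{b. b \<in> {1..n} \<and> (\<forall>p\<in>?A. \<not> p dvd b)} \<subseteq> {1}" by blast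
  hence "sieved_sum ?A n \<le> (\<Sum>b\<in>{1}. 1 / real b)"
    unfolding sieved_sum_def by (intro sum_mono2) auto
  hence "P * harm n \<le> 1"
    using euler_product_mult_harm_le_sieved_sum[of ?A n] unfolding P_def
    by (simp add: in_prime_factors_iff)
  moreover have "P * ln (real n + 1) \<le> P * harm n"
    using \<open>P \<ge> 0\<close> harm_ge_ln by (intro mult_left_mono) auto
  ultimately have "real k * (P * ln (real n + 1)) \<le> real k * 1"
    by (intro mult_left_mono) auto
  thus ?thesis using totient_formula2[of k] by (simp add: P_def mult_ac)
qed

section \<open>Sums over units\<close>

text \<open>Representatives are integers, to be multiplied and reduced freely. For
  \<open>n = 1\<close> the set is \<open>{0}\<close>, so its size is still
  \<open>totient n\<close>.\<close>

definition unit_residues :: "nat \<Rightarrow> int set" where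
  "unit_residues n = {u. 0 \<le> u \<and> u < int n \<and> coprime u (int n)}"

lemma finite_unit_residues [simp]: "finite (unit_residues n)"
  by (rule finite_subset[of _ "{0..<int n}"]) (auto simp: unit_residues_def)

lemma unit_residues_eq_totatives: "n > 1 \<Longrightarrow> unit_residues n = int ` totatives n"
proof (intro equalityI subsetI)
  fix u assume n: "n > 1" and "u \<in> unit_residues n"
  hence u: "0 \<le> u" "u < int n" "coprime u (int n)" by (auto simp: unit_residues_def)
  moreover have "u \<noteq> 0" using u n by auto
  ultimately have "nat u \<in> totatives n"
    by (auto simp: totatives_def) (metis coprime_int_iff int_nat_eq)
  thus "u \<in> int ` totatives n" using u by (intro image_eqI[of _ _ "nat u"]) auto
qed (auto simp: unit_residues_def totatives_less in_totatives_iff)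

lemma card_unit_residues: "n > 0 \<Longrightarrow> card (unit_residues n) = totient n"
proof (cases "n > 1")
  case True
  thus ?thesis by (simp add: unit_residues_eq_totatives card_image totient_def)
next
  case False
  assume "n > 0"
  with False have n: "n = 1" by simp
  have "unit_residues 1 = {0}" by (auto simp: unit_residues_def)
  thus ?thesis by (simp add: n)
qed

text \<open>Cancellation of \<open>t\<close> gives injectivity, finiteness the rest. The set
  \<open>A\<close> is left open to cover both the full residue system and the units.\<close>

lemma bij_betw_mult_mod:
  fixes t n :: int
  assumes "coprime t n" "A \<subseteq> {0..<n}" "\<And>u. u \<in> A \<Longrightarrow> t * u mod n \<in> A"
  shows "bij_betw (\<lambda>u. t * u mod n) A A"
proof -
  have fin: "finite A" using assms(2) finite_subset by blast
  have inj: "inj_on (\<lambda>u. t * u mod n) A"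
  proof (rule inj_onI)
    fix u v assume uv: "u \<in> A" "v \<in> A" "t * u mod n = t * v mod n"
    hence "[u = v] (mod n)" using cong_mult_lcancel[OF assms(1)] by (auto simp: cong_def)
    thus "u = v" using uv assms(2) by (auto simp: cong_def subset_iff)
  qed
  have "(\<lambda>u. t * u mod n) ` A = A"
    using assms(3) by (intro endo_inj_surj fin inj) auto
  thus ?thesis using inj by (simp add: bij_betw_def)
qed

lemma sum_mult_mod:
  fixes f :: "int \<Rightarrow> 'a :: comm_monoid_add"
  assumes "coprime t n" "A \<subseteq> {0..<n}" "\<And>u. u \<in> A \<Longrightarrow> t * u mod n \<in> A"
    and "\<And>x. f (x mod n) = f x"
  shows "(\<Sum>u\<in>A. f (t * u)) = (\<Sum>u\<in>A. f u)"
  using sum.reindex_bij_betw[OF bij_betw_mult_mod[OF assms(1-3)], of f] by (simp add: assms(4))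

lemma sum_units_mult:
  fixes f :: "int \<Rightarrow> 'a :: comm_monoid_add"
  assumes "n > 0" "coprime t (int n)" "\<And>x. f (x mod int n) = f x"
  shows "(\<Sum>u\<in>unit_residues n. f (t * u)) = (\<Sum>u\<in>unit_residues n. f u)"
  using assms by (intro sum_mult_mod[of t "int n"]) (auto simp: unit_residues_def)

lemma sum_residues_mult:
  fixes f :: "int \<Rightarrow> 'a :: comm_monoid_add"
  assumes "n > 0" "coprime t (int n)" "\<And>x. f (x mod int n) = f x"
  shows "(\<Sum>u\<in>{0..<int n}. f (t * u)) = (\<Sum>u\<in>{0..<int n}. f u)"
  using assms by (intro sum_mult_mod[of t "int n"]) auto

lemma coprime_iff_prime_factors:
  fixes n :: nat
  assumes "n > 0"
  shows "coprime b n \<longleftrightarrow> (\<forall>p\<in>prime_factors n. \<not> p dvd b)"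
proof
  assume "coprime b n"
  thus "\<forall>p\<in>prime_factors n. \<not> p dvd b"
    by (metis coprime_common_divisor_nat in_prime_factors_iff not_prime_1)
next
  assume *: "\<forall>p\<in>prime_factors n. \<not> p dvd b"
  show "coprime b n"
  proof (rule ccontr)
    assume "\<not> coprime b n"
    then obtain p where "prime p" "p dvd gcd b n"
      by (metis coprime_iff_gcd_eq_1 prime_factor_nat)
    with * assms show False by (auto simp: in_prime_factors_iff)
  qed
qed

text \<open>Take \<open>u = b + k * r\<close> with \<open>r\<close> the product of the primes of
  \<open>n\<close> that do not divide \<open>b\<close>. A prime of \<open>n\<close> dividing
  \<open>b\<close> divides neither \<open>k\<close> nor \<open>r\<close>; any other divides
  \<open>r\<close> but not \<open>b\<close>. For \<open>k dvd n\<close> this is surjectivity of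
  reduction on units.\<close>

lemma exists_coprime_lift:
  assumes "n > 0" "coprime b (int k)"
  obtains u where "coprime u (int n)" "u mod int k = b mod int k"
proof -
  define R where "R = {p \<in> prime_factors n. \<not> int p dvd b}"
  define r where "r = \<Prod>R"
  define u where "u = b + int k * int r"
  have finR: "finite R" by (simp add: R_def)
  have "\<not> p dvd nat \<bar>u\<bar>" if p: "prime p" "p dvd n" for p
  proof
    assume "p dvd nat \<bar>u\<bar>"
    hence pu: "int p dvd u" by simp
    show False
    proof (cases "int p dvd b")
      case True
      hence "int p dvd int k * int r" using pu by (simp add: u_def dvd_add_right_iff)
      moreover have "\<not> p dvd k"
        using True assms(2) p coprime_common_divisor[of b "int k" "int p"] by auto
      ultimately have "p dvd r" using p
        by (metis int_dvd_int_iff of_nat_mult prime_dvd_mult_iff)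
      then obtain p' where "p' \<in> R" "p dvd p'"
        using p finR by (auto simp: r_def prime_dvd_prod_iff)
      hence "p = p'" using p primes_dvd_imp_eq by (auto simp: R_def)
      with \<open>p' \<in> R\<close> True show False by (simp add: R_def)
    next
      case False
      hence "p \<in> R" using p assms by (auto simp: R_def in_prime_factors_iff)
      hence "p dvd r" using finR by (auto simp: r_def intro: dvd_prodI)
      hence "int p dvd int k * int r" by simp
      with pu False show False by (simp add: u_def dvd_add_left_iff)
    qed
  qed
  hence "coprime (nat \<bar>u\<bar>) n"
    unfolding coprime_iff_prime_factors[OF assms(1)] by (blast dest: in_prime_factors_imp_prime in_prime_factors_imp_dvd)
  hence "coprime \<bar>u\<bar> (int n)" by (metis coprime_int_iff int_nat_eq abs_ge_zero)
  hence "coprime u (int n)" by simp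
  moreover have "u mod int k = b mod int k" by (simp add: u_def)
  ultimately show ?thesis using that by blast
qed

text \<open>The reduction of the units modulo \<open>n\<close> to the units modulo \<open>k\<close> is equidistributed. Both
  sides are evaluations of the sum of \<open>f (b * u)\<close> over all units \<open>b\<close> modulo \<open>k\<close> and \<open>u\<close> modulo \<open>n\<close>.\<close>
lemma sum_units_reduce:
  fixes f :: "int \<Rightarrow> real"
  assumes "n > 0" "k dvd n" and per: "\<And>x. f (x mod int k) = f x"
  shows "real (totient k) * (\<Sum>u\<in>unit_residues n. f u) = real (totient n) * (\<Sum>b\<in>unit_residues k. f b)"
proof -
  have k: "k > 0" using assms by (auto intro: Nat.gr0I)
  have per': "f x = f y" if "x mod int k = y mod int k" for x y
    using per[of x] per[of y] that by simp
  have per_n: "f (x mod int n) = f x" for x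
    using assms(2) by (intro per') (simp add: mod_mod_cancel)
  have 1: "(\<Sum>u\<in>unit_residues n. f (b * u)) = (\<Sum>u\<in>unit_residues n. f u)"
    if "b \<in> unit_residues k" for b
  proof -
    from that have "coprime b (int k)" by (simp add: unit_residues_def)
    then obtain t where t: "coprime t (int n)" "t mod int k = b mod int k"
      using exists_coprime_lift[OF assms(1)] by blast
    \<comment> \<open>\<open>b\<close> need not be a unit modulo \<open>n\<close>, but
      \<open>f\<close> sees only residues modulo \<open>k\<close>, so the lift \<open>t\<close> may
      take its place.\<close>
    have "(\<Sum>u\<in>unit_residues n. f (b * u)) = (\<Sum>u\<in>unit_residues n. f (t * u))"
      by (intro sum.cong refl per') (metis mod_mult_left_eq t(2))
    also have "\<dots> = (\<Sum>u\<in>unit_residues n. f u)" by (intro sum_units_mult assms t per_n)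
    finally show ?thesis .
  qed
  have 2: "(\<Sum>b\<in>unit_residues k. f (b * u)) = (\<Sum>b\<in>unit_residues k. f b)"
    if "u \<in> unit_residues n" for u
  proof -
    have "coprime u (int k)"
      using that assms(2) coprime_divisors[of u u "int k" "int n"] by (simp add: unit_residues_def)
    thus ?thesis using sum_units_mult[of k u f] k per by (simp add: mult.commute)
  qed
  have "(\<Sum>b\<in>unit_residues k. \<Sum>u\<in>unit_residues n. f (b * u))
      = (\<Sum>u\<in>unit_residues n. \<Sum>b\<in>unit_residues k. f (b * u))" by (rule sum.swap)
  thus ?thesis using 1 2 card_unit_residues[of n] card_unit_residues[of k] assms(1) k by simp
qed

section \<open>Cosecant sums\<close>

lemma pi_ge_3: "pi \<ge> 3"
  using sin_x_le_x[of "pi / 6"] sin_30 by simp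

lemma sin_ge_cubic: "x \<ge> 0 \<Longrightarrow> sin x \<ge> x - x ^ 3 / (6 :: real)"
proof -
  assume "x \<ge> 0"
  hence "\<bar>sin x - x\<bar> \<le> x ^ 3 / 6"
    using Maclaurin_sin_bound[of x 3] by (simp add: eval_nat_numeral sin_coeff_def)
  thus ?thesis by linarith
qed

text \<open>Otherwise \<open>x = pi / 6\<close> would lie between 17/30 and 2/3, and the cubic
  Taylor bound would push \<open>sin x\<close> above its value 1/2. The point of 17/5 is that its
  square is below 12.\<close>

lemma pi_less_17_5: "pi < 17 / 5"
proof (rule ccontr)
  assume "\<not> pi < 17 / 5"
  define x where "x = pi / 6"
  have x: "x \<ge> 17 / 30" "x \<le> 2 / 3" using \<open>\<not> pi < 17 / 5\<close> pi_less_4 by (auto simp: x_def)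
  have "x ^ 3 \<le> (2 / 3) ^ 3" using x by (intro power_mono) auto
  hence "x - x ^ 3 / 6 > 1 / 2" using x by (simp add: power3_eq_cube)
  moreover have "sin x = 1 / 2" by (simp add: x_def sin_30)
  ultimately show False using sin_ge_cubic[of x] x by simp
qed

text \<open>On the first half of the interval the cubic bound dominates
  \<open>pi * t * (1 - t)\<close> once \<open>pi * pi * t \<le> 6\<close>, which follows from
  \<open>pi * pi < 12\<close>; the second half is its reflection.\<close>

lemma sin_pi_ge:
  assumes "0 \<le> t" "t \<le> 1"
  shows "sin (pi * t) \<ge> 3 * t * (1 - t)"
proof -
  have *: "sin (pi * t) \<ge> 3 * t * (1 - t)" if "0 \<le> t" "t \<le> 1 / 2" for t
  proof -
    have "pi * pi \<le> 17 / 5 * (17 / 5)" using pi_less_17_5 by (intro mult_mono) auto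
    hence "pi * pi * t \<le> 12 * (1 / 2)" using that by (intro mult_mono) auto
    hence "t * pi * (t * (6 - pi * pi * t)) \<ge> 0" using that by auto
    hence "pi * t * (1 - t) \<le> pi * t - (pi * t) ^ 3 / 6"
      by (simp add: algebra_simps power3_eq_cube)
    also have "\<dots> \<le> sin (pi * t)" using that by (intro sin_ge_cubic) auto
    finally have "pi * (t * (1 - t)) \<le> sin (pi * t)" by (simp add: mult.assoc)
    moreover have "3 * (t * (1 - t)) \<le> pi * (t * (1 - t))"
      using that pi_ge_3 by (intro mult_right_mono) auto
    ultimately show ?thesis by (simp add: mult.assoc)
  qed
  show ?thesis
  proof (cases "t \<le> 1 / 2")
    case True
    thus ?thesis using * assms by blast
  next
    case False
    have "sin (pi * (1 - t)) = sin (pi * t)" by (simp add: right_diff_distrib)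
    with *[of "1 - t"] False assms show ?thesis by (simp add: mult_ac)
  qed
qed

text \<open>When \<open>n\<close> divides \<open>a\<close> the value is \<open>1 / 0 = 0\<close>, so such terms drop out of all sums.\<close>
definition inv_sin :: "nat \<Rightarrow> int \<Rightarrow> real" where
  "inv_sin n a = 1 / \<bar>sin (pi * real_of_int a / real n)\<bar>"

lemma abs_sin_add_int_pi: "\<bar>sin (x + pi * real_of_int j)\<bar> = \<bar>sin x\<bar>"
proof -
  have s: "sin (pi * real_of_int j) = 0" by (auto simp: sin_zero_iff_int2 intro!: exI[of _ j])
  hence "cos (pi * real_of_int j) ^ 2 = 1" using sin_cos_squared_add[of "pi * real_of_int j"] by simp
  hence "\<bar>cos (pi * real_of_int j)\<bar> = 1" by (simp add: power2_eq_1_iff abs_if)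
  thus ?thesis using s by (simp add: sin_add abs_mult)
qed

lemma inv_sin_mod: "n > 0 \<Longrightarrow> inv_sin n (a mod int n) = inv_sin n a"
proof -
  assume n: "n > 0"
  have "real_of_int a = real_of_int (a mod int n) + real n * real_of_int (a div int n)"
    by (metis add.commute mult_div_mod_eq of_int_add of_int_mult of_int_of_nat_eq)
  hence "pi * real_of_int a / real n
      = pi * real_of_int (a mod int n) / real n + pi * real_of_int (a div int n)"
    using n by (simp add: field_simps)
  thus ?thesis by (simp add: inv_sin_def abs_sin_add_int_pi)
qed

lemma inv_sin_multiple: "int n dvd a \<Longrightarrow> inv_sin n a = 0"
  using inv_sin_mod[of n a] by (cases "n = 0") (auto simp: inv_sin_def)

text \<open>The parabola below the sine, split into partial fractions, turns cosecants into
  reciprocals of integers.\<close>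

lemma inv_sin_le:
  assumes "0 < b" "b < k"
  shows "inv_sin k (int b) \<le> real k / 3 * (1 / real b + 1 / real (k - b))"
proof -
  define t where "t = real b / real k"
  have t: "0 < t" "t < 1" using assms by (auto simp: t_def)
  have "inv_sin k (int b) = 1 / \<bar>sin (pi * t)\<bar>" by (simp add: inv_sin_def t_def)
  also have "\<dots> \<le> 1 / (3 * t * (1 - t))"
    proof (rule divide_left_mono)
    have pos: "3 * t * (1 - t) > 0" using t by auto
    show "3 * t * (1 - t) \<le> \<bar>sin (pi * t)\<bar>" using sin_pi_ge[of t] t by simp
    thus "\<bar>sin (pi * t)\<bar> * (3 * t * (1 - t)) > 0" using pos by (metis mult_pos_pos order_less_le_trans)
  qed simp
  also have "\<dots> = 1 / 3 * (1 / t + 1 / (1 - t))" using t by (simp add: field_simps)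
  also have "1 / t + 1 / (1 - t) = real k * (1 / real b + 1 / real (k - b))"
    using assms by (simp add: t_def field_simps of_nat_diff)
  finally show ?thesis by simp
qed

text \<open>The reflection of \<open>b\<close> to \<open>k - b\<close> preserves the totatives, so
  both partial fractions contribute the same sieved sum. The constant 8/9 is 2/3 times 4/3.\<close>

lemma sum_inv_sin_le:
  assumes "k > 1"
  shows "(\<Sum>b\<in>unit_residues k. inv_sin k b)
    \<le> 8 / 9 * real (totient k) * (ln (real k) + 3 * ln (real (rad k)) + 1)"
proof -
  have refl: "k - b \<in> totatives k \<and> k - (k - b) = b" if b: "b \<in> totatives k" for b
  proof -
    have "b < k" using totatives_less[OF b] assms by simp
    then obtain c where c: "k = b + c" "c > 0" using less_imp_add_positive by blast
    have "coprime b (b + c)" using b c by (simp add: in_totatives_iff)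
    hence "gcd b (b + c) = 1" by (rule coprime_imp_gcd_eq_1)
    hence "gcd b c = 1" by simp
    hence "gcd c (b + c) = 1" by (subst gcd.commute) simp
    hence "coprime c k" unfolding c(1) by (rule gcd_eq_1_imp_coprime)
    moreover have "k - b = c" "k - c = b" "c \<le> k" using c(1) by auto
    ultimately show ?thesis using c(2) by (simp only: in_totatives_iff simp_thms)
  qed
  hence refl_bij: "bij_betw (\<lambda>b. k - b) (totatives k) (totatives k)"
    by (intro bij_betw_byWitness[where f' = "\<lambda>b. k - b"] ballI image_subsetI) simp_all
  have "(\<Sum>b\<in>unit_residues k. inv_sin k b) = (\<Sum>b\<in>totatives k. inv_sin k (int b))"
    unfolding unit_residues_eq_totatives[OF assms] by (subst sum.reindex) auto
  also have "\<dots> \<le> (\<Sum>b\<in>totatives k. real k / 3 * (1 / real b + 1 / real (k - b)))"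
  proof (intro sum_mono inv_sin_le)
    fix b assume b: "b \<in> totatives k"
    show "0 < b" using b by (simp add: in_totatives_iff)
    show "b < k" by (rule totatives_less[OF b assms])
  qed
  also have "\<dots> = real k / 3 * ((\<Sum>b\<in>totatives k. 1 / real b) + (\<Sum>b\<in>totatives k. 1 / real (k - b)))"
    by (simp only: sum_distrib_left[symmetric] sum.distrib)
  also have "\<dots> = 2 / 3 * (real k * sieved_sum (prime_factors k) k)"
  proof -
    have "(\<Sum>b\<in>totatives k. 1 / real (k - b)) = (\<Sum>b\<in>totatives k. 1 / real b)"
      using sum.reindex_bij_betw[OF refl_bij, of "\<lambda>b. 1 / real b"] by simp
    moreover have "coprime b k \<longleftrightarrow> (\<forall>p\<in>prime_factors k. \<not> p dvd b)" for b
      using assms by (intro coprime_iff_prime_factors) auto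
    hence "totatives k = {b. b \<in> {1..k} \<and> (\<forall>p\<in>prime_factors k. \<not> p dvd b)}"
      by (auto simp: in_totatives_iff)
    ultimately show ?thesis by (simp only: sieved_sum_def) simp
  qed
  also have "\<dots> \<le> 2 / 3 * (4 / 3 * real (totient k) * (ln (real k) + 3 * ln (real (rad k)) + 1))"
    using assms by (intro mult_left_mono sieved_sum_prime_factors_le) auto
  finally show ?thesis by simp
qed

text \<open>Bounds the average of \<open>inv_sin n (a * u)\<close> over the units \<open>u\<close>,
  which is why the factor \<open>totient n\<close> is left out.\<close>

definition csc_bound :: "nat \<Rightarrow> real" where
  "csc_bound n = 8 / 9 * (ln (real n) + 3 * ln (real (rad n)) + 1)"

lemma csc_bound_pos: "n > 0 \<Longrightarrow> csc_bound n > 0"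
  using rad_pos[of n] by (auto simp: csc_bound_def add_nonneg_pos intro!: add_nonneg_pos)

text \<open>Cancelling the gcd \<open>g\<close> turns \<open>a / n\<close> into \<open>c / k\<close>
  in lowest terms. The units modulo \<open>n\<close> are equidistributed over those modulo
  \<open>k\<close>, multiplication by \<open>c\<close> permutes the latter, and the bound only grows
  from \<open>k\<close> to \<open>n\<close>.\<close>

lemma sum_units_inv_sin_le:
  assumes "n > 0"
  shows "(\<Sum>u\<in>unit_residues n. inv_sin n (a * u)) \<le> csc_bound n * real (totient n)"
proof (cases "int n dvd a")
  case True
  hence "(\<Sum>u\<in>unit_residues n. inv_sin n (a * u)) = 0"
    by (intro sum.neutral ballI inv_sin_multiple) auto
  thus ?thesis using csc_bound_pos[OF assms] by simp
next
  case False
  define g where "g = nat (gcd a (int n))"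
  have g: "int g = gcd a (int n)" "g > 0" using assms by (auto simp: g_def)
  have "g dvd n" using g by (metis gcd_dvd2 int_dvd_int_iff)
  then obtain k where k: "n = g * k" by (elim dvdE)
  obtain c where c: "a = int g * c" using g by (metis gcd_dvd1 dvdE)
  have "k > 0" using assms k by auto
  have "k \<noteq> 1" using False c k by auto
  hence k1: "k > 1" using \<open>k > 0\<close> by simp
  have "coprime c (int k)"
  proof -
    have "int g * gcd c (int k) = gcd (int g * c) (int g * int k)"
      using gcd_mult_left[of "int g" c "int k"] by simp
    also have "\<dots> = gcd a (int n)" by (simp only: c k of_nat_mult)
    also have "\<dots> = int g" using g(1) by simp
    finally show ?thesis using g(2) by (simp add: coprime_iff_gcd_eq_1)
  qed
  have conv: "inv_sin n (a * u) = inv_sin k (c * u)" for u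
    using g k c by (simp add: inv_sin_def mult.assoc)
  let ?f = "\<lambda>u. inv_sin k (c * u)"
  have per: "?f (x mod int k) = ?f x" for x
    using inv_sin_mod[OF \<open>k > 0\<close>, of "c * x"] inv_sin_mod[OF \<open>k > 0\<close>, of "c * (x mod int k)"]
    by (simp add: mod_mult_right_eq)
  have "real (totient k) * (\<Sum>u\<in>unit_residues n. inv_sin n (a * u))
      = real (totient n) * (\<Sum>b\<in>unit_residues k. inv_sin k (c * b))"
    unfolding conv by (rule sum_units_reduce) (use assms k per in auto)
  also have "(\<Sum>b\<in>unit_residues k. inv_sin k (c * b)) = (\<Sum>b\<in>unit_residues k. inv_sin k b)"
    using \<open>k > 0\<close> \<open>coprime c (int k)\<close> by (intro sum_units_mult inv_sin_mod)
  finally have eq: "real (totient k) * (\<Sum>u\<in>unit_residues n. inv_sin n (a * u))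
      = real (totient n) * (\<Sum>b\<in>unit_residues k. inv_sin k b)" .
  have "k \<le> n" "rad k \<le> rad n" using k assms g rad_mono[of k n] by auto
  hence le: "ln (real k) \<le> ln (real n)" "ln (real (rad k)) \<le> ln (real (rad n))"
    using \<open>k > 0\<close> rad_pos[of k] by auto
  have "(\<Sum>b\<in>unit_residues k. inv_sin k b)
      \<le> 8 / 9 * real (totient k) * (ln (real k) + 3 * ln (real (rad k)) + 1)"
    by (rule sum_inv_sin_le[OF k1])
  also have "\<dots> \<le> 8 / 9 * real (totient k) * (ln (real n) + 3 * ln (real (rad n)) + 1)"
    using le by (intro mult_left_mono) auto
  also have "\<dots> = real (totient k) * csc_bound n" by (simp add: csc_bound_def)
  finally have "real (totient n) * (\<Sum>b\<in>unit_residues k. inv_sin k b)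
      \<le> real (totient n) * (real (totient k) * csc_bound n)"
    by (intro mult_left_mono) auto
  with eq have "real (totient k) * (\<Sum>u\<in>unit_residues n. inv_sin n (a * u))
     \<le> real (totient k) * (csc_bound n * real (totient n))" by (simp only: mult_ac)
  moreover have "real (totient k) > 0" using \<open>k > 0\<close> by simp
  ultimately show ?thesis by (rule mult_left_le_imp_le)
qed

section \<open>Completion of character sums\<close>

definition add_char :: "nat \<Rightarrow> int \<Rightarrow> complex" where
  "add_char n a = cis (2 * pi * real_of_int a / real n)"

lemma norm_add_char [simp]: "norm (add_char n a) = 1"
  by (simp add: add_char_def)

lemma add_char_0 [simp]: "add_char n 0 = 1"
  by (simp add: add_char_def)

lemma add_char_add: "add_char n (a + b) = add_char n a * add_char n b"
  by (simp add: add_char_def cis_mult ring_distribs add_divide_distrib)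

lemma cnj_add_char: "cnj (add_char n a) = add_char n (- a)"
  by (simp add: add_char_def cis_cnj)

lemma add_char_power: "add_char n a ^ k = add_char n (a * int k)"
  by (induction k) (simp_all add: add_char_add algebra_simps)

lemma add_char_multiple: "n > 0 \<Longrightarrow> int n dvd a \<Longrightarrow> add_char n a = 1"
proof -
  assume "n > 0" "int n dvd a"
  then obtain k where "2 * pi * real_of_int a / real n = 2 * pi * real_of_int k"
    by (auto elim!: dvdE)
  thus ?thesis by (simp only: add_char_def cis_multiple_2pi Ints_of_int)
qed

lemma add_char_cong:
  assumes "n > 0" "a mod int n = b mod int n"
  shows "add_char n a = add_char n b"
proof -
  have "int n dvd a - b" using assms mod_eq_dvd_iff by blast
  hence "add_char n (b + (a - b)) = add_char n b"
    unfolding add_char_add using assms by (simp add: add_char_multiple)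
  thus ?thesis by simp
qed

lemma norm_add_char_minus_1: "norm (add_char n a - 1) = 2 * \<bar>sin (pi * real_of_int a / real n)\<bar>"
proof -
  define x where "x = pi * real_of_int a / real n"
  have "add_char n a - 1 = cis x * (cis x - cis (- x))"
    by (simp add: add_char_def x_def right_diff_distrib cis_mult mult.assoc)
  also have "cis x - cis (- x) = 2 * \<i> * complex_of_real (sin x)"
    by (simp add: complex_eq_iff)
  finally show ?thesis by (simp add: norm_mult x_def)
qed

lemma sin_pi_div_eq_0_iff: "n > 0 \<Longrightarrow> sin (pi * real_of_int a / real n) = 0 \<longleftrightarrow> int n dvd a"
proof -
  assume n: "n > 0"
  have "sin (pi * real_of_int a / real n) = 0 \<longleftrightarrow> (\<exists>i::int. pi * real_of_int a / real n = real_of_int i * pi)"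
    by (rule sin_zero_iff_int2)
  also have "\<dots> \<longleftrightarrow> (\<exists>i::int. real_of_int a = real_of_int (int n * i))"
    using n by (simp add: field_simps)
  also have "\<dots> \<longleftrightarrow> int n dvd a" by (simp only: of_int_eq_iff dvd_def)
  finally show ?thesis .
qed

lemma add_char_eq_1_iff: "n > 0 \<Longrightarrow> add_char n a = 1 \<longleftrightarrow> int n dvd a"
  using norm_add_char_minus_1[of n a] sin_pi_div_eq_0_iff[of n a] by auto

text \<open>In the closed form of the geometric sum the numerator is at most 2 and the denominator
  is twice a sine. Independence of \<open>N\<close> is what makes the final estimates uniform in
  \<open>x\<close>.\<close>

lemma norm_sum_add_char_le:
  assumes "n > 0" "\<not> int n dvd a"
  shows "norm (\<Sum>j<N. add_char n (a * int j)) \<le> inv_sin n a"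
proof -
  let ?z = "add_char n a"
  have z: "?z \<noteq> 1" using assms add_char_eq_1_iff by blast
  have "(\<Sum>j<N. add_char n (a * int j)) = (?z ^ N - 1) / (?z - 1)"
    using geometric_sum[OF z, of N] by (simp add: add_char_power)
  moreover have "norm (?z ^ N - 1) \<le> 2"
    using norm_triangle_ineq4[of "?z ^ N" 1] by (simp add: norm_power)
  moreover have "norm (?z - 1) > 0" using z by simp
  ultimately have "norm (\<Sum>j<N. add_char n (a * int j)) \<le> 2 / norm (?z - 1)"
    by (simp add: norm_divide divide_right_mono)
  thus ?thesis by (simp add: norm_add_char_minus_1 inv_sin_def)
qed

text \<open>Orthogonality: the ratio is an \<open>n\<close>-th root of unity, so the geometric sum
  vanishes unless the ratio is 1.\<close>

lemma sum_add_char: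
  assumes "n > 0"
  shows "(\<Sum>a\<in>{0..<int n}. add_char n (a * m)) = (if int n dvd m then of_nat n else 0)"
proof -
  have img: "{0..<int n} = int ` {..<n}"
    by (auto simp: image_int_atLeastLessThan lessThan_atLeast0)
  have "(\<Sum>a\<in>{0..<int n}. add_char n (a * m)) = (\<Sum>j<n. add_char n m ^ j)"
    unfolding img by (simp add: sum.reindex add_char_power mult.commute)
  also have "\<dots> = (if int n dvd m then of_nat n else 0)"
  proof (cases "int n dvd m")
    case False
    hence "add_char n m \<noteq> 1" using assms add_char_eq_1_iff by blast
    moreover have "add_char n m ^ n = 1" using assms by (simp add: add_char_power add_char_multiple)
    ultimately show ?thesis using False by (simp add: geometric_sum)
  qed (simp add: add_char_multiple assms)
  finally show ?thesis .
qed

section \<open>Fourier coefficients of a Dirichlet character\<close>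

locale dirichlet_char =
  fixes q :: nat and chi :: "int \<Rightarrow> complex"
  assumes q_pos: "q > 0" and char: "dirichlet_character q chi"
begin

lemma chi_mult: "chi (m * n) = chi m * chi n"
  using char by (simp add: dirichlet_character_def)

lemma chi_eq_0_iff: "chi n = 0 \<longleftrightarrow> \<not> coprime n (int q)"
  using char by (auto simp: dirichlet_character_def)

lemma chi_add_multiple: "chi (n + int q * k) = chi n"
proof -
  have *: "chi (n + int q * int j) = chi n" for n j
  proof (induction j)
    case (Suc j)
    have "chi (n + int q * int j + int q) = chi (n + int q * int j)"
      using char unfolding dirichlet_character_def by blast
    with Suc show ?case by (simp add: algebra_simps)
  qed simp
  show ?thesis
  proof (cases "k \<ge> 0")
    case True
    thus ?thesis using *[of n "nat k"] by simp
  next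
    case False
    thus ?thesis using *[of "n + int q * k" "nat (- k)"] by simp
  qed
qed

lemma chi_mod: "chi (n mod int q) = chi n"
  using chi_add_multiple[of "n mod int q" "n div int q"] by simp

lemma chi_cong: "a mod int q = b mod int q \<Longrightarrow> chi a = chi b"
  by (metis chi_mod)

lemma chi_1: "chi 1 = 1"
  using chi_mult[of 1 1] chi_eq_0_iff[of 1] by auto

lemma chi_power: "chi (m ^ k) = chi m ^ k"
  by (induction k) (simp_all add: chi_1 chi_mult)

text \<open>By Euler's theorem the value at a unit is a root of unity.\<close>

lemma norm_chi: "norm (chi u) = (if coprime u (int q) then 1 else 0)"
proof (cases "coprime u (int q)")
  case True
  define m where "m = nat (u mod int q)"
  have m: "int m = u mod int q" using q_pos by (simp add: m_def)
  have "coprime (int m) (int q)" using True q_pos by (simp add: m)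
  hence "[m ^ totient q = 1] (mod q)" by (intro euler_theorem) simp
  hence "[int (m ^ totient q) = int 1] (mod int q)" by (simp only: cong_int_iff)
  hence "chi (int m ^ totient q) = chi 1" by (intro chi_cong) (simp add: cong_def)
  hence "chi u ^ totient q = 1" by (simp add: chi_power m chi_mod chi_1)
  hence "norm (chi u) ^ totient q = 1 ^ totient q" by (metis norm_one norm_power power_one)
  hence "norm (chi u) = 1" by (rule power_eq_imp_eq_base) (use q_pos in auto)
  thus ?thesis using True by simp
qed (use chi_eq_0_iff in auto)

lemma sum_chi_eq_0:
  assumes "chi \<noteq> principal_character q"
  shows "(\<Sum>m\<in>{0..<int q}. chi m) = 0"
proof -
  \<comment> \<open>Both characters vanish off the units, so they differ at some unit; multiplying
    the sum by \<open>chi u\<close> merely permutes its terms.\<close>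
  obtain u where u: "coprime u (int q)" "chi u \<noteq> 1"
    using assms chi_eq_0_iff by (fastforce simp: principal_character_def)
  have "chi u * (\<Sum>m\<in>{0..<int q}. chi m) = (\<Sum>m\<in>{0..<int q}. chi (u * m))"
    by (simp add: sum_distrib_left chi_mult)
  also have "\<dots> = (\<Sum>m\<in>{0..<int q}. chi m)"
    using q_pos u chi_mod by (intro sum_residues_mult)
  finally show ?thesis using u by simp
qed

text \<open>The unnormalised finite Fourier coefficient of \<open>chi\<close> at frequency
  \<open>a\<close>, for primitive and imprimitive \<open>chi\<close> alike.\<close>

definition gauss :: "int \<Rightarrow> complex" where
  "gauss a = (\<Sum>m\<in>{0..<int q}. chi m * add_char q (- (a * m)))"

lemma gauss_mod: "gauss (a mod int q) = gauss a"
proof -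
  have "add_char q (- (a mod int q * m)) = add_char q (- (a * m))" for m
    by (intro add_char_cong q_pos mod_minus_cong) (simp add: mod_mult_left_eq)
  thus ?thesis by (simp add: gauss_def)
qed

text \<open>Substituting \<open>u * m\<close> for \<open>m\<close> shows that
  \<open>chi u * gauss (u * a) = gauss a\<close>, and \<open>chi u\<close> has absolute value
  1.\<close>

lemma norm_gauss_mult:
  assumes "coprime u (int q)"
  shows "norm (gauss (u * a)) = norm (gauss a)"
proof -
  let ?f = "\<lambda>m. chi m * add_char q (- (a * m))"
  have "chi u * gauss (u * a) = (\<Sum>m\<in>{0..<int q}. ?f (u * m))"
    by (simp add: gauss_def sum_distrib_left chi_mult mult_ac)
  also have "\<dots> = (\<Sum>m\<in>{0..<int q}. ?f m)"
  proof (rule sum_residues_mult[OF q_pos assms])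
    fix x
    have "add_char q (- (a * (x mod int q))) = add_char q (- (a * x))"
      using q_pos by (intro add_char_cong mod_minus_cong) (simp_all add: mod_mult_right_eq)
    thus "?f (x mod int q) = ?f x" by (simp add: chi_mod)
  qed
  finally have "norm (chi u * gauss (u * a)) = norm (gauss a)" by (simp add: gauss_def)
  thus ?thesis using assms by (simp add: norm_mult norm_chi)
qed

text \<open>Fourier inversion: orthogonality leaves only the term
  \<open>k = m mod q\<close>.\<close>

lemma gauss_inversion: "(\<Sum>a\<in>{0..<int q}. gauss a * add_char q (a * m)) = of_nat q * chi m"
proof -
  let ?R = "{0..<int q}"
  have "(\<Sum>a\<in>?R. gauss a * add_char q (a * m))
      = (\<Sum>a\<in>?R. \<Sum>k\<in>?R. chi k * add_char q (a * (m - k)))"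
    unfolding gauss_def sum_distrib_right
    by (intro sum.cong refl) (simp add: mult.assoc add_char_add[symmetric] algebra_simps)
  also have "\<dots> = (\<Sum>k\<in>?R. chi k * (\<Sum>a\<in>?R. add_char q (a * (m - k))))"
    by (subst sum.swap) (simp add: sum_distrib_left)
  also have "\<dots> = (\<Sum>k\<in>?R. if k = m mod int q then of_nat q * chi m else 0)"
  proof (rule sum.cong)
    fix k assume "k \<in> ?R"
    hence "int q dvd m - k \<longleftrightarrow> k = m mod int q"
      by (auto simp: mod_eq_dvd_iff[symmetric])
    thus "chi k * (\<Sum>a\<in>?R. add_char q (a * (m - k))) = (if k = m mod int q then of_nat q * chi m else 0)"
      using q_pos by (simp add: sum_add_char chi_mod)
  qed simp
  also have "\<dots> = of_nat q * chi m" using q_pos by simp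
  finally show ?thesis .
qed

text \<open>Expanding the conjugate factor and applying inversion leaves \<open>q\<close> times the
  sum of \<open>norm (chi k) ^ 2\<close>, which counts the units. The count \<open>totient q\<close>
  in place of \<open>q\<close> is the source of the saving.\<close>

lemma gauss_parseval: "(\<Sum>a\<in>{0..<int q}. (norm (gauss a))\<^sup>2) = real q * real (totient q)"
proof -
  let ?R = "{0..<int q}"
  have "complex_of_real (\<Sum>a\<in>?R. (norm (gauss a))\<^sup>2) = (\<Sum>a\<in>?R. gauss a * cnj (gauss a))"
    unfolding of_real_sum by (intro sum.cong refl complex_norm_square)
  also have "\<dots> = (\<Sum>a\<in>?R. \<Sum>k\<in>?R. cnj (chi k) * (gauss a * add_char q (a * k)))"
    by (intro sum.cong refl) (subst (2) gauss_def, simp add: sum_distrib_left cnj_add_char mult_ac)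
  also have "\<dots> = (\<Sum>k\<in>?R. cnj (chi k) * (\<Sum>a\<in>?R. gauss a * add_char q (a * k)))"
    by (subst sum.swap) (simp add: sum_distrib_left)
  also have "\<dots> = of_nat q * (\<Sum>k\<in>?R. chi k * cnj (chi k))"
    unfolding gauss_inversion by (subst sum_distrib_left) (simp add: mult_ac)
  also have "(\<Sum>k\<in>?R. chi k * cnj (chi k)) = (\<Sum>k\<in>?R. if coprime k (int q) then 1 else 0)"
    by (intro sum.cong refl) (simp add: complex_norm_square[symmetric] norm_chi)
  also have "\<dots> = of_nat (card {k \<in> ?R. coprime k (int q)})"
    by (simp add: sum.inter_filter[symmetric])
  also have "{k \<in> ?R. coprime k (int q)} = unit_residues q" by (auto simp: unit_residues_def)
  also have "of_nat q * of_nat (card (unit_residues q)) = complex_of_real (real q * real (totient q))"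
    using q_pos by (simp add: card_unit_residues)
  finally show ?thesis by (simp only: of_real_eq_iff)
qed

text \<open>The Cauchy-Schwarz inequality against the constant 1, combined with Parseval's
  identity.\<close>

lemma sum_norm_gauss_le: "(\<Sum>a\<in>{0..<int q}. norm (gauss a)) \<le> real q * sqrt (real (totient q))"
proof -
  have "(\<Sum>a\<in>{0..<int q}. norm (gauss a))\<^sup>2 \<le> real q * (real q * real (totient q))"
    using sum_squared_le_sum_of_squares[of "\<lambda>a. norm (gauss a)" "{0..<int q}"]
    by (simp add: gauss_parseval mult_ac)
  hence "(\<Sum>a\<in>{0..<int q}. norm (gauss a)) \<le> sqrt ((real q)\<^sup>2 * real (totient q))"
    by (intro real_le_rsqrt) (simp add: power2_eq_square mult_ac)
  thus ?thesis by (simp add: real_sqrt_mult)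
qed

text \<open>Since \<open>norm (gauss a)\<close> only depends on the orbit of \<open>a\<close> under the units, the weights
  \<open>inv_sin q a\<close> may be replaced by their averages over these orbits.\<close>
lemma sum_gauss_inv_sin_le:
  "(\<Sum>a\<in>{0..<int q}. norm (gauss a) * inv_sin q a) \<le> csc_bound q * (\<Sum>a\<in>{0..<int q}. norm (gauss a))"
proof -
  let ?R = "{0..<int q}" and ?U = "unit_residues q"
  have "real (totient q) * (\<Sum>a\<in>?R. norm (gauss a) * inv_sin q a)
      = (\<Sum>u\<in>?U. \<Sum>a\<in>?R. norm (gauss a) * inv_sin q a)"
    using q_pos by (simp add: card_unit_residues)
  also have "\<dots> = (\<Sum>u\<in>?U. \<Sum>a\<in>?R. norm (gauss (u * a)) * inv_sin q (u * a))"
    using q_pos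
    by (intro sum.cong refl sum_residues_mult[symmetric])
       (auto simp: gauss_mod inv_sin_mod unit_residues_def)
  also have "\<dots> = (\<Sum>u\<in>?U. \<Sum>a\<in>?R. norm (gauss a) * inv_sin q (a * u))"
    by (intro sum.cong refl) (simp add: norm_gauss_mult unit_residues_def mult.commute)
  also have "\<dots> = (\<Sum>a\<in>?R. norm (gauss a) * (\<Sum>u\<in>?U. inv_sin q (a * u)))"
    by (subst sum.swap) (simp add: sum_distrib_left)
  also have "\<dots> \<le> (\<Sum>a\<in>?R. norm (gauss a) * (csc_bound q * real (totient q)))"
    using q_pos by (intro sum_mono mult_left_mono sum_units_inv_sin_le) auto
  also have "\<dots> = real (totient q) * (csc_bound q * (\<Sum>a\<in>?R. norm (gauss a)))"
    by (simp add: sum_distrib_right[symmetric])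
  finally show ?thesis using q_pos by (simp add: mult_le_cancel_left_pos)
qed

text \<open>Completion in the manner of Polya and Vinogradov: Fourier inversion replaces
  \<open>chi\<close> by additive characters, whose sums are geometric. The averaged cosecant weights
  then leave only the sum of the \<open>norm (gauss a)\<close>.\<close>

theorem character_sum_le:
  assumes "chi \<noteq> principal_character q"
  shows "norm (\<Sum>m\<in>{1..M}. chi m) \<le> csc_bound q * sqrt (real (totient q))"
proof -
  let ?R = "{0..<int q}"
  \<comment> \<open>At \<open>a = 0\<close> the right side is 0 because
    \<open>inv_sin q 0 = 0\<close>; the bound survives since \<open>gauss 0\<close>, the sum of
    \<open>chi\<close> over a period, vanishes.\<close>
  have term_le: "norm (gauss a * (\<Sum>m\<in>{1..M}. add_char q (a * m))) \<le> norm (gauss a) * inv_sin q a"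
    if "a \<in> ?R" for a
  proof (cases "a = 0")
    case True
    thus ?thesis using sum_chi_eq_0[OF assms] by (simp add: gauss_def)
  next
    case False
    hence nd: "\<not> int q dvd a" using that by (auto dest: zdvd_imp_le)
    have "{1..M} = (\<lambda>j. 1 + int j) ` {..<nat M}"
    proof (intro equalityI subsetI)
      fix m assume "m \<in> {1..M}"
      thus "m \<in> (\<lambda>j. 1 + int j) ` {..<nat M}"
        by (intro image_eqI[of _ _ "nat (m - 1)"]) auto
    qed auto
    hence "(\<Sum>m\<in>{1..M}. add_char q (a * m)) = (\<Sum>j<nat M. add_char q (a * (1 + int j)))"
      by (simp add: sum.reindex inj_on_def)
    also have "\<dots> = add_char q a * (\<Sum>j<nat M. add_char q (a * int j))"
      by (simp add: sum_distrib_left add_char_add distrib_left)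
    finally have "norm (\<Sum>m\<in>{1..M}. add_char q (a * m)) \<le> inv_sin q a"
      using norm_sum_add_char_le[OF q_pos nd] by (simp add: norm_mult)
    thus ?thesis by (simp add: norm_mult mult_left_mono)
  qed
  have "of_nat q * (\<Sum>m\<in>{1..M}. chi m)
      = (\<Sum>m\<in>{1..M}. \<Sum>a\<in>?R. gauss a * add_char q (a * m))"
    by (simp add: gauss_inversion sum_distrib_left)
  also have "\<dots> = (\<Sum>a\<in>?R. gauss a * (\<Sum>m\<in>{1..M}. add_char q (a * m)))"
    by (subst sum.swap) (simp add: sum_distrib_left)
  finally have "real q * norm (\<Sum>m\<in>{1..M}. chi m)
      = norm (\<Sum>a\<in>?R. gauss a * (\<Sum>m\<in>{1..M}. add_char q (a * m)))"
    by (metis norm_mult norm_of_nat)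
  also have "\<dots> \<le> (\<Sum>a\<in>?R. norm (gauss a) * inv_sin q a)"
    by (rule sum_norm_le) (rule term_le)
  also have "\<dots> \<le> csc_bound q * (\<Sum>a\<in>?R. norm (gauss a))" by (rule sum_gauss_inv_sin_le)
  also have "\<dots> \<le> csc_bound q * (real q * sqrt (real (totient q)))"
    using csc_bound_pos[OF q_pos] by (intro mult_left_mono sum_norm_gauss_le) auto
  finally have "real q * norm (\<Sum>m\<in>{1..M}. chi m) \<le> real q * (csc_bound q * sqrt (real (totient q)))"
    by (simp add: mult_ac)
  thus ?thesis using q_pos by (simp add: mult_le_cancel_left_pos)
qed

end

section \<open>Characters modulo a square\<close>

lemma sum_lessThan_blocks:
  fixes f :: "nat \<Rightarrow> 'a :: comm_monoid_add"
  shows "(\<Sum>m<N. f m) = (\<Sum>v<N div H. \<Sum>u<H. f (u + H * v)) + (\<Sum>u<N mod H. f (u + H * (N div H)))"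
proof -
  let ?a = "N div H"
  have sh: "(\<Sum>m\<in>{k..<k + n}. f m) = (\<Sum>u<n. f (u + k))" for k n
    using sum.shift_bounds_nat_ivl[of f 0 k n] by (simp add: lessThan_atLeast0 add.commute)
  have "(\<Sum>m<N. f m) = sum f ({..<?a * H} \<union> {?a * H..<?a * H + N mod H})"
    by (subst ivl_disj_un_one(2)) simp_all
  also have "\<dots> = (\<Sum>m<?a * H. f m) + (\<Sum>m\<in>{?a * H..<?a * H + N mod H}. f m)"
    by (rule sum.union_disjoint) auto
  also have "(\<Sum>m<?a * H. f m) = (\<Sum>v<?a. \<Sum>m\<in>{v * H..<v * H + H}. f m)"
    by (rule sum.nat_group[symmetric])
  finally show ?thesis by (simp only: sh mult.commute)
qed

lemma sum_lessThan_int: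
  "(\<Sum>u<n. f (int u)) = (\<Sum>u\<in>{0..<int n}. f u)"
proof -
  have "{0..<int n} = int ` {..<n}"
    by (auto simp: image_int_atLeastLessThan lessThan_atLeast0)
  thus ?thesis by (simp add: sum.reindex)
qed

context dirichlet_char
begin

text \<open>For \<open>q > 1\<close> the value \<open>chi 0\<close> is 0, so the sum may start at 0,
  as the division into blocks requires. For negative \<open>M\<close> both sums are empty.\<close>

lemma sum_chi_eq_sum_lessThan:
  assumes "q > 1"
  shows "(\<Sum>m\<in>{1..M}. chi m) = (\<Sum>m<nat (M + 1). chi (int m))"
proof -
  have "chi 0 = 0" using assms chi_eq_0_iff[of 0] by auto
  have "(\<Sum>m<nat (M + 1). chi (int m)) = (\<Sum>m\<in>{0..<int (nat (M + 1))}. chi m)"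
    by (rule sum_lessThan_int)
  also have "\<dots> = (\<Sum>m\<in>{1..M}. chi m)"
  proof (rule sum.mono_neutral_right)
    show "\<forall>i\<in>{0..<int (nat (M + 1))} - {1..M}. chi i = 0"
    proof
      fix i assume "i \<in> {0..<int (nat (M + 1))} - {1..M}"
      hence "i = 0" by (auto split: if_splits)
      thus "chi i = 0" using \<open>chi 0 = 0\<close> by simp
    qed
  qed auto
  finally show ?thesis ..
qed

end

text \<open>If \<open>q = H\<^sup>2\<close>, then \<open>v \<mapsto> chi (1 + H * v)\<close> is an additive character modulo \<open>H\<close>, so the character
  sum splits into geometric sums over the residue classes modulo \<open>H\<close>. This works for all
  nonprincipal characters alike and avoids any reduction to primitive ones.\<close>
locale dirichlet_char_square = dirichlet_char +
  fixes H :: nat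
  assumes q_eq: "q = H\<^sup>2" and H_gt_1: "H > 1"
begin

lemma q_gt_1: "q > 1"
  using H_gt_1 one_less_power[of H 2] by (simp add: q_eq)

lemma coprime_q_iff: "coprime x (int q) \<longleftrightarrow> coprime x (int H)"
  by (simp add: q_eq)

definition psi :: "int \<Rightarrow> complex" where
  "psi v = chi (1 + int H * v)"

text \<open>The cross term \<open>H * H * v * w\<close> is a multiple of \<open>q\<close>.\<close>

lemma psi_add: "psi (v + w) = psi v * psi w"
proof -
  have "(1 + int H * v) * (1 + int H * w) = 1 + int H * (v + w) + int q * (v * w)"
    by (simp add: q_eq power2_eq_square algebra_simps)
  hence "chi ((1 + int H * v) * (1 + int H * w)) = chi (1 + int H * (v + w))"
    by (simp only: chi_add_multiple)
  thus ?thesis by (simp add: psi_def chi_mult)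
qed

lemma psi_add_multiple: "psi (v + int H * k) = psi v"
proof -
  have "1 + int H * (v + int H * k) = 1 + int H * v + int q * k"
    by (simp add: q_eq power2_eq_square algebra_simps)
  thus ?thesis unfolding psi_def by (simp only: chi_add_multiple)
qed

text \<open>\<open>psi\<close> has period \<open>H\<close> and is multiplicative on sums, so
  \<open>psi 1\<close> is an \<open>H\<close>-th root of unity and determines
  \<open>psi\<close>.\<close>

lemma psi_eq_add_char: obtains c where "\<And>v. psi v = add_char H (c * v)"
proof -
  have pow: "psi (int j) = psi 1 ^ j" for j
  proof (induction j)
    case (Suc j)
    have "psi (int j + 1) = psi (int j) * psi 1" by (rule psi_add)
    with Suc show ?case by (simp add: add.commute mult.commute)
  qed (simp add: psi_def chi_1)
  have "psi 1 ^ H = 1" using pow[of H] psi_add_multiple[of 0 1] by (simp add: psi_def chi_1)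
  hence "psi 1 \<in> (\<lambda>k. cis (2 * pi * real k / real H)) ` {..<H}"
    using Complex.bij_betw_roots_unity[of H] H_gt_1 by (auto simp: bij_betw_def)
  then obtain c where "psi 1 = add_char H (int c)" by (auto simp: add_char_def)
  hence *: "psi (int j) = add_char H (int c * int j)" for j
    by (simp add: pow add_char_power)
  have "psi v = add_char H (int c * v)" for v
  proof -
    define j where "j = nat (v mod int H)"
    have j: "int j = v mod int H" using H_gt_1 by (simp add: j_def)
    have "psi v = psi (int j)" using psi_add_multiple[of "int j" "v div int H"] by (simp add: j)
    also have "\<dots> = add_char H (int c * int j)" by (rule *)
    also have "\<dots> = add_char H (int c * v)"
      using H_gt_1 by (intro add_char_cong) (simp_all add: j mod_mult_right_eq)
    finally show ?thesis .
  qed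
  thus ?thesis using that by blast
qed

text \<open>With \<open>w\<close> inverse to \<open>u\<close>, the number \<open>u + H * v\<close>
  is congruent to \<open>u * (1 + H * (w * v))\<close> modulo \<open>q\<close>.\<close>

lemma chi_progression:
  assumes "[u * w = 1] (mod int q)"
  shows "chi (u + int H * v) = chi u * psi (w * v)"
proof -
  obtain t where t: "u * w = 1 + int q * t"
    using assms by (metis cong_iff_lin cong_sym)
  have "u * (1 + int H * (w * v)) = u + int H * ((u * w) * v)" by (simp add: algebra_simps)
  also have "\<dots> = u + int H * v + int q * (int H * (t * v))" by (simp add: t algebra_simps)
  finally have "chi (u * (1 + int H * (w * v))) = chi (u + int H * v)"
    by (simp only: chi_add_multiple)
  thus ?thesis by (simp add: psi_def chi_mult)
qed

lemma chi_progression_noncoprime: "\<not> coprime u (int H) \<Longrightarrow> chi (u + int H * v) = 0"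
  unfolding chi_eq_0_iff coprime_q_iff
  using gcd_add_mult[of "int H" v u]
  by (simp add: coprime_iff_gcd_eq_1 gcd.commute add.commute mult.commute)

text \<open>The inverses are taken modulo \<open>q\<close>, as \<open>chi_progression\<close>
  demands. Reduced modulo \<open>H\<close> they still permute the units, so sums of periodic
  functions do not notice the inversion.\<close>

lemma unit_inverse:
  obtains w where "\<And>u. u \<in> unit_residues H \<Longrightarrow> [u * w u = 1] (mod int q)"
    and "\<And>g :: int \<Rightarrow> real. (\<And>x. g (x mod int H) = g x) \<Longrightarrow>
           (\<Sum>u\<in>unit_residues H. g (w u)) = (\<Sum>u\<in>unit_residues H. g u)"
    and "\<And>u. u \<in> unit_residues H \<Longrightarrow> coprime (w u) (int H)"
proof -
  have "\<exists>w. [u * w = 1] (mod int q)" if "u \<in> unit_residues H" for u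
    using that by (intro cong_solve_coprime_int) (simp add: coprime_q_iff unit_residues_def)
  then obtain w where w: "\<And>u. u \<in> unit_residues H \<Longrightarrow> [u * w u = 1] (mod int q)"
    by metis
  have wH: "[u * w u = 1] (mod int H)" if "u \<in> unit_residues H" for u
    using w[OF that] by (rule cong_dvd_modulus) (simp add: q_eq)
  have cop: "coprime (w u) (int H)" if "u \<in> unit_residues H" for u
    using wH[OF that] by (metis coprime_iff_invertible_int mult.commute)
  have H0: "int H > 0" using H_gt_1 by simp
  have "inj_on (\<lambda>u. w u mod int H) (unit_residues H)"
  proof (rule inj_onI)
    fix u u' assume u: "u \<in> unit_residues H" "u' \<in> unit_residues H" "w u mod int H = w u' mod int H"
    hence "[w u = w u'] (mod int H)" by (simp add: cong_def)
    hence "[u * u' * w u = u * u' * w u'] (mod int H)" by (rule cong_scalar_left)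
    moreover have "[u' * (u * w u) = u' * 1] (mod int H)" using wH[OF u(1)] by (rule cong_scalar_left)
    moreover have "[u * (u' * w u') = u * 1] (mod int H)" using wH[OF u(2)] by (rule cong_scalar_left)
    ultimately have "[u = u'] (mod int H)" by (simp add: cong_def mult_ac)
    thus "u = u'" using u by (simp add: unit_residues_def cong_def)
  qed
  moreover have "(\<lambda>u. w u mod int H) ` unit_residues H \<subseteq> unit_residues H"
    using cop H0 by (auto simp: unit_residues_def)
  ultimately have bij: "bij_betw (\<lambda>u. w u mod int H) (unit_residues H) (unit_residues H)"
    by (simp add: bij_betw_def endo_inj_surj)
  have "(\<Sum>u\<in>unit_residues H. g (w u)) = (\<Sum>u\<in>unit_residues H. g u)"
    if "\<And>x. g (x mod int H) = g x" for g :: "int \<Rightarrow> real"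
    using sum.reindex_bij_betw[OF bij, of g] that by simp
  with w cop show ?thesis using that by blast
qed

text \<open>Lets the trivial bound \<open>totient H\<close> be absorbed when \<open>psi\<close> is
  trivial.\<close>

lemma csc_bound_ge_1: "csc_bound H \<ge> 1"
proof -
  have "ln (real H) \<ge> ln 2" using H_gt_1 by (subst ln_le_cancel_iff) auto
  moreover have "ln (real (rad H)) \<ge> 0" using rad_pos[of H] by simp
  ultimately show ?thesis using ln2_ge_two_thirds by (simp add: csc_bound_def)
qed

text \<open>If \<open>psi\<close> is trivial, \<open>chi\<close> has period \<open>H\<close>,
  complete blocks cancel and the last block is bounded trivially. Otherwise the class of each unit
  \<open>u\<close> carries a geometric sum of frequency \<open>c * w u\<close>, not divisible by
  \<open>H\<close>, and the cosecant bound applies.\<close>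

theorem character_sum_square_le:
  assumes "chi \<noteq> principal_character q"
  shows "norm (\<Sum>m\<in>{1..M}. chi m) \<le> csc_bound H * real (totient H)"
proof -
  define N where "N = nat (M + 1)"
  define a where "a = N div H"
  define r where "r = N mod H"
  have "r < H" using H_gt_1 by (simp add: r_def)
  let ?U = "unit_residues H"
  have S: "(\<Sum>m\<in>{1..M}. chi m) = (\<Sum>m<N. chi (int m))"
    unfolding N_def by (rule sum_chi_eq_sum_lessThan[OF q_gt_1])
  have blocks: "(\<Sum>m<N. chi (int m)) = (\<Sum>v<a. \<Sum>u<H. chi (int u + int H * int v))
      + (\<Sum>u<r. chi (int u + int H * int a))"
    unfolding a_def r_def using sum_lessThan_blocks[of "\<lambda>m. chi (int m)" N H] by simp
  obtain c where c: "\<And>v. psi v = add_char H (c * v)" by (rule psi_eq_add_char) blast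
  obtain w where w: "\<And>u. u \<in> ?U \<Longrightarrow> [u * w u = 1] (mod int q)"
    "\<And>g :: int \<Rightarrow> real. (\<And>x. g (x mod int H) = g x) \<Longrightarrow> (\<Sum>u\<in>?U. g (w u)) = (\<Sum>u\<in>?U. g u)"
    "\<And>u. u \<in> ?U \<Longrightarrow> coprime (w u) (int H)"
    by (rule unit_inverse) blast
  have unit_iff: "int u \<in> ?U \<longleftrightarrow> coprime (int u) (int H)" if "u < H" for u
    using that by (simp add: unit_residues_def)
  show ?thesis
  proof (cases "int H dvd c")
    case True
    have psi1: "psi v = 1" for v using True H_gt_1 by (simp add: c add_char_multiple)
    have per: "chi (int u + int H * int v) = chi (int u)" if "u < H" for u v
    proof (cases "coprime (int u) (int H)")
      case True
      thus ?thesis using chi_progression[OF w(1)] unit_iff[OF that] by (simp add: psi1)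
    next
      case False
      thus ?thesis using chi_progression_noncoprime[of "int u" "int v"] chi_progression_noncoprime[of "int u" 0]
        by simp
    qed
    \<comment> \<open>A period modulo \<open>q\<close> consists of \<open>H\<close> identical
      blocks, so one block inherits the vanishing of the full sum.\<close>
    have "of_nat H * (\<Sum>u<H. chi (int u)) = (\<Sum>v<H. \<Sum>u<H. chi (int u + int H * int v))"
      by (simp add: per)
    also have "\<dots> = (\<Sum>m<q. chi (int m))"
      using sum_lessThan_blocks[of "\<lambda>m. chi (int m)" q H] H_gt_1
      by (simp add: q_eq power2_eq_square)
    also have "\<dots> = 0" unfolding sum_lessThan_int by (rule sum_chi_eq_0[OF assms])
    finally have zero: "(\<Sum>u<H. chi (int u)) = 0" using H_gt_1 by simp
    have "norm (\<Sum>m\<in>{1..M}. chi m) = norm (\<Sum>u<r. chi (int u))"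
      unfolding S blocks using \<open>r < H\<close> by (simp add: per zero)
    also have "\<dots> \<le> (\<Sum>u<r. norm (chi (int u)))" by (rule norm_sum)
    also have "\<dots> \<le> (\<Sum>u<H. norm (chi (int u)))" using \<open>r < H\<close> by (intro sum_mono2) auto
    also have "\<dots> = (\<Sum>u\<in>{0..<int H}. if coprime u (int H) then 1 else 0)"
      unfolding sum_lessThan_int[of "\<lambda>u. norm (chi u)"] by (simp add: norm_chi coprime_q_iff)
    also have "\<dots> = real (card {u \<in> {0..<int H}. coprime u (int H)})"
      by (simp add: sum.inter_filter[symmetric])
    also have "{u \<in> {0..<int H}. coprime u (int H)} = ?U" by (auto simp: unit_residues_def)
    also have "real (card ?U) = 1 * real (totient H)" using H_gt_1 by (simp add: card_unit_residues)
    also have "\<dots> \<le> csc_bound H * real (totient H)"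
      using csc_bound_ge_1 by (intro mult_right_mono) auto
    finally show ?thesis .
  next
    case False
    \<comment> \<open>\<open>V u\<close> counts the numbers below \<open>N = a * H + r\<close> in
      the residue class of \<open>u\<close>; the classes below \<open>r\<close> have one
      more.\<close>
    define V where "V u = (if u < int r then a + 1 else a)" for u
    have "(\<Sum>m<N. chi (int m)) = (\<Sum>u<H. \<Sum>v<V (int u). chi (int u + int H * int v))"
    proof -
      have "(\<Sum>u<r. chi (int u + int H * int a)) = (\<Sum>u<H. if u < r then chi (int u + int H * int a) else 0)"
        using \<open>r < H\<close> by (subst sum.inter_filter[symmetric]) (auto intro!: sum.cong)
      hence "(\<Sum>m<N. chi (int m)) = (\<Sum>u<H. (\<Sum>v<a. chi (int u + int H * int v))
          + (if u < r then chi (int u + int H * int a) else 0))"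
        unfolding blocks by (subst sum.swap) (simp add: sum.distrib)
      also have "\<dots> = (\<Sum>u<H. \<Sum>v<V (int u). chi (int u + int H * int v))"
        by (intro sum.cong) (auto simp: V_def)
      finally show ?thesis .
    qed
    also have "\<dots> = (\<Sum>u\<in>{0..<int H}. \<Sum>v<V u. chi (u + int H * int v))"
      by (rule sum_lessThan_int)
    also have "\<dots> = (\<Sum>u\<in>?U. \<Sum>v<V u. chi (u + int H * int v))"
      by (intro sum.mono_neutral_right) (auto simp: unit_residues_def chi_progression_noncoprime)
    finally have "norm (\<Sum>m\<in>{1..M}. chi m) \<le> (\<Sum>u\<in>?U. norm (\<Sum>v<V u. chi (u + int H * int v)))"
      unfolding S by (simp add: norm_sum)
    also have "\<dots> \<le> (\<Sum>u\<in>?U. inv_sin H (c * w u))"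
    proof (rule sum_mono)
      fix u assume u: "u \<in> ?U"
      have nd: "\<not> int H dvd c * w u"
        using False w(3)[OF u] by (simp add: coprime_dvd_mult_left_iff coprime_commute)
      have "(\<Sum>v<V u. chi (u + int H * int v)) = chi u * (\<Sum>v<V u. add_char H (c * w u * int v))"
        by (simp add: chi_progression[OF w(1)[OF u]] c sum_distrib_left mult.assoc)
      moreover have "norm (chi u) = 1" using u by (simp add: norm_chi coprime_q_iff unit_residues_def)
      ultimately show "norm (\<Sum>v<V u. chi (u + int H * int v)) \<le> inv_sin H (c * w u)"
        using norm_sum_add_char_le[OF _ nd] H_gt_1 by (simp add: norm_mult)
    qed
    also have "\<dots> = (\<Sum>u\<in>?U. inv_sin H (c * u))"
    proof (rule w(2))
      fix x show "inv_sin H (c * (x mod int H)) = inv_sin H (c * x)"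
        using inv_sin_mod[of H "c * x"] inv_sin_mod[of H "c * (x mod int H)"] H_gt_1
        by (simp add: mod_mult_right_eq)
    qed
    also have "\<dots> \<le> csc_bound H * real (totient H)"
      using H_gt_1 by (intro sum_units_inv_sin_le) auto
    finally show ?thesis .
  qed
qed

end

section \<open>Density and asymptotics\<close>

text \<open>There are \<open>X div P\<close> positive multiples of \<open>P\<close> up to
  \<open>X\<close>, and the threshold discards at most \<open>Q\<close> of them.\<close>

lemma has_natural_density_multiples:
  assumes "P > 0"
  shows "has_natural_density {q. P dvd q \<and> Q \<le> q} (1 / real P)"
proof -
  define A where "A X = {n \<in> {q. P dvd q \<and> Q \<le> q}. 1 \<le> n \<and> n \<le> X}" for X :: nat
  define B where "B X = {n. P dvd n \<and> 1 \<le> n \<and> n \<le> X}" for X :: nat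
  have finB: "finite (B X)" for X by (rule finite_subset[of _ "{1..X}"]) (auto simp: B_def)
  have "B X = (\<lambda>j. P * j) ` {1..X div P}" for X
    using assms by (auto simp: B_def less_eq_div_iff_mult_less_eq mult.commute Suc_le_eq elim!: dvdE)
  hence cardB: "card (B X) = X div P" for X
    using assms by (simp add: card_image inj_on_def)
  have up: "real (card (A X)) \<le> real X / real P" for X
  proof -
    have "card (A X) \<le> card (B X)" by (intro card_mono finB) (auto simp: A_def B_def)
    hence "real (card (A X)) \<le> real (X div P)" by (simp add: cardB)
    also have "\<dots> \<le> real X / real P" by (rule of_nat_div_le_of_nat)
    finally show ?thesis .
  qed
  have low: "real X / real P - 1 - real Q \<le> real (card (A X))" for X
  proof -
    have "B X \<subseteq> A X \<union> {..<Q}" by (auto simp: A_def B_def)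
    moreover have "finite (A X)" by (rule finite_subset[of _ "{1..X}"]) (auto simp: A_def)
    ultimately have "card (B X) \<le> card (A X \<union> {..<Q})" by (intro card_mono) auto
    also have "\<dots> \<le> card (A X) + Q" using card_Un_le[of "A X" "{..<Q}"] by simp
    finally have "real (X div P) \<le> real (card (A X)) + real Q" by (simp add: cardB)
    moreover have "real X / real P - 1 \<le> real (X div P)"
      using real_of_int_floor_gt_diff_one[of "real X / real P"]
      by (simp add: floor_divide_of_nat_eq)
    ultimately show ?thesis by linarith
  qed
  have lim: "(\<lambda>X. 1 / real P - (1 + real Q) / real X) \<longlonglongrightarrow> 1 / real P"
    using tendsto_diff[OF tendsto_const lim_const_over_n[of "1 + real Q"]] by simp
  have "(\<lambda>X. real (card (A X)) / real X) \<longlonglongrightarrow> 1 / real P"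
  proof (rule tendsto_sandwich[OF _ _ lim tendsto_const])
    show "\<forall>\<^sub>F X in sequentially. 1 / real P - (1 + real Q) / real X \<le> real (card (A X)) / real X"
      using eventually_gt_at_top[of 0]
    proof eventually_elim
      case (elim X)
      thus ?case using divide_right_mono[OF low[of X], of "real X"] by (simp add: diff_divide_distrib add_divide_distrib)
    qed
    show "\<forall>\<^sub>F X in sequentially. real (card (A X)) / real X \<le> 1 / real P"
      using eventually_gt_at_top[of 0]
    proof eventually_elim
      case (elim X)
      thus ?case using divide_right_mono[OF up[of X], of "real X"] by simp
    qed
  qed
  thus ?thesis by (simp add: has_natural_density_def A_def)
qed

text \<open>The iterated logarithms are eventually positive, so the estimates need only reach
  \<open>ln q + 4\<close>.\<close>

lemma eventually_log_factor_gt: "\<forall>\<^sub>F q in sequentially. log_factor q > ln (real q) + 4"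
  unfolding log_factor_def by real_asymp

lemma log_factor_asymp: "(\<lambda>q. log_factor q / ln (real q) - 1) \<longlonglongrightarrow> 0"
  unfolding log_factor_def by real_asymp

text \<open>The Euler constant is below 13/22, and comparing 22nd powers reduces the claim to
  \<open>2.72 ^ 13 < 1.81 ^ 22\<close>.\<close>

lemma exp_euler_mascheroni_less: "exp (euler_mascheroni :: real) < 181 / 100"
proof -
  have "exp (13 / 22 :: real) ^ 22 = exp 1 ^ 13"
    by (simp add: exp_of_nat_mult[symmetric])
  also have "\<dots> < (272 / 100) ^ 13" using e_less_272 by (intro power_strict_mono) auto
  also have "\<dots> < (181 / 100 :: real) ^ 22" by (simp add: power_divide)
  finally have "exp (13 / 22 :: real) < 181 / 100" by (rule power_less_imp_less_base) simp
  moreover have "exp (euler_mascheroni :: real) < exp (13 / 22)"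
    using euler_mascheroni_less_13_over_22 by simp
  ultimately show ?thesis by linarith
qed

text \<open>Makes \<open>ln q\<close> and \<open>ln (ln q)\<close> positive for
  \<open>q \<ge> 3\<close>, so that the asymptotic identities may divide by them.\<close>

lemma ln_gt_1: "q \<ge> 3 \<Longrightarrow> ln (real q) > 1"
proof -
  assume "q \<ge> 3"
  hence "exp 1 < real q" using e_less_272 by linarith
  thus ?thesis by (metis exp_gt_zero ln_exp ln_less_cancel_iff order_less_trans)
qed

text \<open>Since \<open>rad q \<le> q\<close>, the cosecant bound is at most
  \<open>4 * (ln q + 4)\<close>. Divisibility by \<open>fact n\<close> gains the factor
  \<open>L = sqrt (ln (n + 1))\<close>, so \<open>n\<close> is chosen with
  \<open>L > 4 / c\<close>.\<close>

lemma norm_character_sum_less_multiples: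
  assumes "c > 0"
  obtains n Q where "\<And>q chi M. fact n dvd q \<Longrightarrow> q \<ge> Q \<Longrightarrow> nonprincipal_character q chi \<Longrightarrow>
    norm (\<Sum>m\<in>{1..M}. chi m) < c * sqrt (real q) * log_factor q"
proof -
  obtain Q where Q: "\<And>q. q \<ge> Q \<Longrightarrow> log_factor q > ln (real q) + 4"
    using eventually_log_factor_gt by (auto simp: eventually_sequentially)
  have "filterlim (\<lambda>n. sqrt (ln (real n + 1))) at_top sequentially" by real_asymp
  hence "\<forall>\<^sub>F n in sequentially. sqrt (ln (real n + 1)) > 4 / c"
    by (simp add: filterlim_at_top_dense)
  then obtain n where n: "sqrt (ln (real n + 1)) > 4 / c"
    by (auto simp: eventually_sequentially)
  define L where "L = sqrt (ln (real n + 1))"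
  have "4 / c > 0" using assms by simp
  hence "L > 0" using n unfolding L_def by linarith
  have "4 < L * c" using n assms unfolding L_def by (simp add: pos_divide_less_eq)
  hence L: "L > 0" "4 / L < c" using \<open>L > 0\<close> by (simp_all add: pos_divide_less_eq mult.commute)
  have "norm (\<Sum>m\<in>{1..M}. chi m) < c * sqrt (real q) * log_factor q"
    if q: "fact n dvd q" "q \<ge> max Q 1" and chi: "nonprincipal_character q chi" for q chi M
  proof -
    have q1: "q > 0" using q by simp
    interpret dirichlet_char q chi using chi q1 by unfold_locales (auto simp: nonprincipal_character_def)
    have "ln (real q) \<ge> 0" using q1 by simp
    have "ln (real (rad q)) \<le> ln (real q)" using rad_le[OF q1] rad_pos[of q] q1 by simp
    hence csc: "csc_bound q \<le> 4 * (ln (real q) + 4)"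
      using \<open>ln (real q) \<ge> 0\<close> by (simp add: csc_bound_def)
    have "real (totient q) * L\<^sup>2 \<le> real q"
      using totient_mult_ln_le[OF q(1) q1] by (simp add: L_def)
    hence "sqrt (real (totient q) * L\<^sup>2) \<le> sqrt (real q)" by simp
    hence tot: "sqrt (real (totient q)) \<le> sqrt (real q) / L"
      using L by (simp add: real_sqrt_mult field_simps)
    have "norm (\<Sum>m\<in>{1..M}. chi m) \<le> csc_bound q * sqrt (real (totient q))"
      using chi by (intro character_sum_le) (simp add: nonprincipal_character_def)
    also have "\<dots> \<le> 4 * (ln (real q) + 4) * (sqrt (real q) / L)"
      using csc tot \<open>ln (real q) \<ge> 0\<close> by (intro mult_mono) auto
    also have "\<dots> = 4 / L * (sqrt (real q) * (ln (real q) + 4))" by simp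
    also have "\<dots> \<le> c * (sqrt (real q) * (ln (real q) + 4))"
      using L \<open>ln (real q) \<ge> 0\<close> by (intro mult_right_mono) auto
    also have "\<dots> < c * (sqrt (real q) * log_factor q)"
      using assms Q[of q] q q1 by (intro mult_strict_left_mono) auto
    finally show ?thesis by (simp add: mult.assoc)
  qed
  thus ?thesis using that by blast
qed

text \<open>Here \<open>sqrt q = H\<close>, \<open>ln q = 200 * F\<close> and
  \<open>ln (rad H) \<le> F\<close>. The bound for squares is thus of size
  \<open>8 / 9 * 103 * F * H / ln (n + 1)\<close>, against a target of
  \<open>200 * F * H / (exp euler_mascheroni * ln (ln q))\<close>, where \<open>ln (ln q)\<close> is
  asymptotic to \<open>ln n\<close>.\<close>

lemma norm_character_sum_less_squares:
  obtains n0 where "\<And>n chi M. n \<ge> n0 \<Longrightarrow> nonprincipal_character ((fact n ^ 100)\<^sup>2) chi \<Longrightarrow>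
    norm (\<Sum>m\<in>{1..M}. chi m) < sqrt (real ((fact n ^ 100)\<^sup>2))
      / (exp euler_mascheroni * ln (ln (real ((fact n ^ 100)\<^sup>2)))) * log_factor ((fact n ^ 100)\<^sup>2)"
proof -
  obtain Q where Q: "\<And>q. q \<ge> Q \<Longrightarrow> log_factor q > ln (real q) + 4"
    using eventually_log_factor_gt by (auto simp: eventually_sequentially)
  \<comment> \<open>The factor must lie between \<open>8 / 9 * 103 / 200 * 181 / 100\<close>, about
    0.829, and 1. The argument of the logarithm is an upper bound for \<open>ln q\<close>.\<close>
  have "\<forall>\<^sub>F n in sequentially. 83 / 100 * ln (200 * (real n * ln (real n))) \<le> ln (real n + 1)"
    by real_asymp
  then obtain n1 where n1: "\<And>n. n \<ge> n1 \<Longrightarrow> 83 / 100 * ln (200 * (real n * ln (real n))) \<le> ln (real n + 1)"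
    by (auto simp: eventually_sequentially)
  have "norm (\<Sum>m\<in>{1..M}. chi m) < sqrt (real ((fact n ^ 100)\<^sup>2))
      / (exp euler_mascheroni * ln (ln (real ((fact n ^ 100)\<^sup>2)))) * log_factor ((fact n ^ 100)\<^sup>2)"
    if n: "n \<ge> Max {2, Q, n1}" and chi: "nonprincipal_character ((fact n ^ 100)\<^sup>2) chi" for n chi M
  proof -
    define H :: nat where "H = fact n ^ 100"
    define q where "q = H\<^sup>2"
    define F where "F = ln (fact n :: real)"
    have n2: "n \<ge> 2" "n \<ge> Q" "n \<ge> n1" using n by auto
    have fact2: "fact n \<ge> (2 :: nat)" using fact_mono_nat[OF n2(1)] by simp
    have "H \<ge> fact n" unfolding H_def by (intro self_le_power) auto
    hence H: "H > 1" "H \<ge> n" using fact2 fact_ge_self[of n] by linarith+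
    have "q \<ge> H" unfolding q_def by (intro self_le_power) (use H in auto)
    hence "q > 0" "q \<ge> Q" using H n2 by auto
    interpret dirichlet_char_square q chi H
      using chi \<open>q > 0\<close> H by unfold_locales (auto simp: nonprincipal_character_def q_def H_def)
    have lnH: "ln (real H) = 100 * F" by (simp add: H_def F_def ln_realpow)
    have lnq: "ln (real q) = 200 * F" using H by (simp add: q_def lnH ln_realpow)
    have "(2 :: real) \<le> fact n" using fact2 by (metis of_nat_fact of_nat_le_iff of_nat_numeral)
    hence "ln 2 \<le> F" unfolding F_def by (intro iffD2[OF ln_le_cancel_iff]) auto
    hence F: "F \<ge> 2 / 3" using ln2_ge_two_thirds by linarith
    have F_le: "F \<le> real n * ln (real n)"
    proof -
      have "(fact n :: real) \<le> of_nat (n ^ n)" by (rule fact_le_power)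
      hence "(fact n :: real) \<le> real n ^ n" by simp
      hence "F \<le> ln (real n ^ n)" unfolding F_def using n2 by (subst ln_le_cancel_iff) auto
      thus ?thesis using n2 by (simp add: ln_realpow)
    qed
    have "prime_factors H = prime_factors (fact n)" unfolding H_def by (rule prime_factors_power) simp
    hence "rad H \<le> fact n" using rad_le[of "fact n"] by (simp add: rad_def)
    hence "real (rad H) \<le> real (fact n)" by (rule of_nat_mono)
    hence "real (rad H) \<le> fact n" by simp
    hence "ln (real (rad H)) \<le> F"
      unfolding F_def using rad_pos[of H] by (intro iffD2[OF ln_le_cancel_iff]) auto
    \<comment> \<open>The summand 1 is rounded up to \<open>103 / 50\<close> so that
      \<open>F + 1 / 50\<close> matches \<open>ln q + 4 = 200 * (F + 1 / 50)\<close>.\<close>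
    hence csc: "csc_bound H \<le> 8 / 9 * 103 * (F + 1 / 50)"
      by (simp add: csc_bound_def lnH)
    define D where "D = ln (real n + 1)"
    define K where "K = ln (200 * F)"
    have D: "D > 0" unfolding D_def using n2 by simp
    have K: "K > 0" unfolding K_def using F by (intro ln_gt_zero) auto
    have "real (totient H) * D \<le> real H"
      unfolding D_def using H by (intro totient_mult_ln_le) (auto simp: H_def)
    hence tot: "real (totient H) \<le> real H / D" using D by (simp add: field_simps)
    have "K \<le> ln (200 * (real n * ln (real n)))"
      unfolding K_def using F F_le by (intro iffD2[OF ln_le_cancel_iff]) auto
    hence KD: "83 / 100 * K \<le> D" using n1[OF n2(3)] unfolding D_def by linarith
    have "exp euler_mascheroni * K \<le> 181 / 100 * K"
      using exp_euler_mascheroni_less K by (intro mult_right_mono) auto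
    \<comment> \<open>Numerically \<open>8 / 9 * 103 * 181 / 100 < 200 * 83 / 100\<close>; here the
      leading constant beats \<open>exp (- euler_mascheroni)\<close>.\<close>
    hence KD': "8 / 9 * 103 * (exp euler_mascheroni * K) \<le> 200 * D" using KD K by linarith
    have "norm (\<Sum>m\<in>{1..M}. chi m) \<le> csc_bound H * real (totient H)"
      using chi by (intro character_sum_square_le) (simp add: nonprincipal_character_def q_def H_def)
    also have "\<dots> \<le> 8 / 9 * 103 * (F + 1 / 50) * (real H / D)"
      using csc tot F by (intro mult_mono) auto
    also have "\<dots> = (8 / 9 * 103 / D) * (real H * (F + 1 / 50))" by simp
    also have "\<dots> \<le> (200 / (exp euler_mascheroni * K)) * (real H * (F + 1 / 50))"
      using KD' D K F by (intro mult_right_mono) (auto simp: field_simps)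
    also have "\<dots> = real H / (exp euler_mascheroni * K) * (ln (real q) + 4)"
    proof -
      have "ln (real q) + 4 = 200 * (F + 1 / 50)" by (simp add: lnq)
      thus ?thesis by (simp only: times_divide_eq_left times_divide_eq_right mult_ac)
    qed
    also have "\<dots> < real H / (exp euler_mascheroni * K) * log_factor q"
      using Q[OF \<open>q \<ge> Q\<close>] H K by (intro mult_strict_left_mono) auto
    finally show ?thesis
      by (simp add: K_def lnq[symmetric] H_def[symmetric] q_def[symmetric]) (simp add: q_def)
  qed
  thus ?thesis using that by blast
qed

theorem corollary1p3:
  shows "(\<forall>c::real. c > 0 \<longrightarrow>
           (\<exists>N \<subseteq> {3::nat..}.
              (\<exists>d>0. has_natural_density N d) \<and>
              (\<forall>q\<in>N. \<forall>chi. nonprincipal_character q chi \<longrightarrow>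
                 (\<forall>x::real. norm (\<Sum>m\<in>{1..\<lfloor>x\<rfloor>}. chi m) < c * sqrt (real q) * log_factor q))) \<and>
           (\<exists>e::nat \<Rightarrow> real. e \<longlonglongrightarrow> 0 \<and>
              (\<forall>q\<ge>3. c * sqrt (real q) * log_factor q
                      = (c + e q) * sqrt (real q) * ln (real q))))
       \<and>
         infinite {q::nat. q \<ge> 3 \<and>
           (\<forall>chi. nonprincipal_character q chi \<longrightarrow>
              (\<forall>x::real. norm (\<Sum>m\<in>{1..\<lfloor>x\<rfloor>}. chi m)
                 < sqrt (real q) / (exp euler_mascheroni * ln (ln (real q))) * log_factor q))}
       \<and>
         (\<exists>e::nat \<Rightarrow> real. e \<longlonglongrightarrow> 0 \<and>
            (\<forall>q\<ge>3. sqrt (real q) / (exp euler_mascheroni * ln (ln (real q))) * log_factor q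
                    = (exp (- euler_mascheroni) + e q) * (sqrt (real q) * ln (real q) / ln (ln (real q)))))"
    (is "?part1 \<and> infinite ?S \<and> ?asymp")
proof (intro conjI)
  show ?part1
  proof (intro allI impI conjI)
    fix c :: real
    assume c: "c > 0"
    obtain n Q where bound: "\<And>q chi M. fact n dvd q \<Longrightarrow> q \<ge> Q \<Longrightarrow> nonprincipal_character q chi \<Longrightarrow>
        norm (\<Sum>m\<in>{1..M}. chi m) < c * sqrt (real q) * log_factor q"
      by (rule norm_character_sum_less_multiples[OF c]) blast
    show "\<exists>N \<subseteq> {3::nat..}. (\<exists>d>0. has_natural_density N d) \<and>
        (\<forall>q\<in>N. \<forall>chi. nonprincipal_character q chi \<longrightarrow>
          (\<forall>x::real. norm (\<Sum>m\<in>{1..\<lfloor>x\<rfloor>}. chi m) < c * sqrt (real q) * log_factor q))"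
    \<comment> \<open>The threshold \<open>max Q 3\<close> makes the bound available and keeps
      \<open>q\<close> where the iterated logarithms are defined, at no cost in density.\<close>
    proof (intro exI[of _ "{q. fact n dvd q \<and> max Q 3 \<le> q}"] conjI)
      show "\<exists>d>0. has_natural_density {q. fact n dvd q \<and> max Q 3 \<le> q} d"
        using has_natural_density_multiples[of "fact n" "max Q 3"]
        by (intro exI[of _ "1 / real (fact n)"]) simp
    qed (use bound in auto)
    \<comment> \<open>The error is solved from the required identity; it tends to 0 because
      \<open>log_factor q\<close> is asymptotic to \<open>ln q\<close>.\<close>
    define e where "e q = c * (log_factor q / ln (real q) - 1)" for q
    have "e \<longlonglongrightarrow> 0" unfolding e_def by (rule tendsto_mult_right_zero[OF log_factor_asymp])
    moreover have "c * sqrt (real q) * log_factor q = (c + e q) * sqrt (real q) * ln (real q)"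
      if "q \<ge> 3" for q
      using ln_gt_1[OF that] by (simp add: e_def field_simps)
    ultimately show "\<exists>e::nat \<Rightarrow> real. e \<longlonglongrightarrow> 0 \<and>
        (\<forall>q\<ge>3. c * sqrt (real q) * log_factor q = (c + e q) * sqrt (real q) * ln (real q))"
      by blast
  qed
next
  obtain n0 where n0: "\<And>n chi M. n \<ge> n0 \<Longrightarrow> nonprincipal_character ((fact n ^ 100)\<^sup>2) chi \<Longrightarrow>
    norm (\<Sum>m\<in>{1..M}. chi m) < sqrt (real ((fact n ^ 100)\<^sup>2))
      / (exp euler_mascheroni * ln (ln (real ((fact n ^ 100)\<^sup>2)))) * log_factor ((fact n ^ 100)\<^sup>2)"
    by (rule norm_character_sum_less_squares) blast
  have "\<exists>q>m. q \<in> ?S" for m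
  proof -
    \<comment> \<open>Since \<open>q \<ge> n\<close>, the entry \<open>m + 1\<close> makes the
      moduli unbounded and the entry 3 gives \<open>q \<ge> 3\<close>.\<close>
    define n where "n = Max {n0, m + 1, 3}"
    have n: "n \<ge> n0" "n > m" "n \<ge> 3" by (auto simp: n_def)
    define q :: nat where "q = (fact n ^ 100)\<^sup>2"
    have "n \<le> fact n" by (rule fact_ge_self)
    also have "fact n \<le> (fact n ^ 100 :: nat)" by (intro self_le_power) auto
    also have "\<dots> \<le> q" unfolding q_def by (intro self_le_power) auto
    finally have "q \<ge> n" .
    hence "q > m \<and> q \<in> ?S" using n n0[OF n(1)] unfolding q_def by auto
    thus ?thesis by blast
  qed
  thus "infinite ?S" by (simp only: infinite_nat_iff_unbounded) blast
next
  define e :: "nat \<Rightarrow> real" where "e q = exp (- euler_mascheroni) * (log_factor q / ln (real q) - 1)" for q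
  have "e \<longlonglongrightarrow> 0" unfolding e_def by (rule tendsto_mult_right_zero[OF log_factor_asymp])
  moreover have "sqrt (real q) / (exp euler_mascheroni * ln (ln (real q))) * log_factor q
      = (exp (- euler_mascheroni) + e q) * (sqrt (real q) * ln (real q) / ln (ln (real q)))"
    if "q \<ge> 3" for q
    using ln_gt_1[OF that] by (simp add: e_def exp_minus field_simps)
  ultimately show ?asymp by blast
qed

end
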